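(* Let $n\ge 2$. For every $J\subseteq[n-2]$, the vertically rotated inverse descent class $C_nD_{n-1,J}^{-1}\subseteq\mathfrak{S}_n$ is cyclic Schur-positive.
   Context: Permutations are written in one-line notation and composed right to left. For $\pi\in\mathfrak{S}_n$, $\mathrm{Des}(\pi)=\{i\in[n-1]:\pi(i)>\pi(i+1)\}$ and $\mathrm{cDes}(\pi)=\{i\in[n]:\pi(i)>\pi(i+1)\}$ with $\pi(n+1):=\pi(1)$. For $J\subseteq[n]$, $\mathbf{x}^J=\prod_{i\in J}x_i$, and $i+J=\{i+j\bmod n:j\in J\}\subseteq[n]$. Let $c_n=(1,2,\dots,n)=23\cdots n1$, $C_n=\langle c_n\rangle$. $D_{n-1,J}=\{\pi\in\mathfrak{S}_{n-1}:\mathrm{Des}(\pi)=J\}$ and $D_{n-1,J}^{-1}$ is the set of inverses, viewed inside $\mathfrak{S}_n$ as permutations fixing $n$; $C_nA=\{c\sigma:c\in C_n,\sigma\in A\}$. Cyclic Schur-positivity: for a skew shape $\lambda/\mu$ with $n$ cells, the descent set of $T\in\mathrm{SYT}(\lambda/\mu)$ is the set of $i\in[n-1]$ with $i+1$ in a strictly lower row than $i$. A cyclic descent extension on $\mathrm{SYT}(\lambda/\mu)$ is a pair $(\mathrm{cDes},\psi)$, $\mathrm{cDes}:\mathrm{SYT}(\lambda/\mu)\to2^{[n]}$, $\psi$ a bijection, with $\mathrm{cDes}(T)\cap[n-1]=\mathrm{Des}(T)$, $\mathrm{cDes}(\psi T)=1+\mathrm{cDes}(T)$, $\emptyset\ne\mathrm{cDes}(T)\ne[n]$.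 It exists iff $\lambda/\mu$ is not a connected ribbon, and then $\sum_{T}\mathbf{x}^{\mathrm{cDes}(T)}$ is independent of the choice. $A\subseteq\mathfrak{S}_n$ is cyclic Schur-positive if there are nonnegative integers $m_{\lambda/\mu}$ (over skew shapes with $n$ cells that are not connected ribbons) with $\sum_{\pi\in A}\mathbf{x}^{\mathrm{cDes}(\pi)}=\sum m_{\lambda/\mu}\sum_{T\in\mathrm{SYT}(\lambda/\mu)}\mathbf{x}^{\mathrm{cDes}(T)}$. *)

theory Defs
  imports "HOL-Combinatorics.Permutations" Complex_Main
begin

text \<open>Permutations of [n] = {1..n} are functions nat => nat that permute {1..n}
  (identity elsewhere); composition is function composition (right to left).\<close>

definition Des :: "nat \<Rightarrow> (nat \<Rightarrow> nat) \<Rightarrow> nat set" where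
  "Des n p = {i \<in> {1..n-1}. p i > p (i+1)}"

definition cDes :: "nat \<Rightarrow> (nat \<Rightarrow> nat) \<Rightarrow> nat set" where
  "cDes n p = {i \<in> {1..n}. p i > p (if i = n then 1 else i+1)}"

definition cyc :: "nat \<Rightarrow> nat \<Rightarrow> nat" where
  "cyc n i = (if 1 \<le> i \<and> i < n then i+1 else if i = n then 1 else i)"

text \<open>D_{n-1,J}^{-1}, viewed inside S_n (fixing n)\<close>
definition invDesClass :: "nat \<Rightarrow> nat set \<Rightarrow> (nat \<Rightarrow> nat) set" where
  "invDesClass m J = inv ` {s. s permutes {1..m} \<and> Des m s = J}"

definition rotClass :: "nat \<Rightarrow> (nat \<Rightarrow> nat) set \<Rightarrow> (nat \<Rightarrow> nat) set" where
  "rotClass n A = {(cyc n ^^ k) \<circ> s | k s. k < n \<and> s \<in> A}"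

text \<open>generating function sum_{a in A} x^{f a}, as a polynomial function of x\<close>
definition genf :: "('b \<Rightarrow> nat set) \<Rightarrow> 'b set \<Rightarrow> (nat \<Rightarrow> real) \<Rightarrow> real" where
  "genf f A x = (\<Sum>a\<in>A. \<Prod>i\<in>f a. x i)"

text \<open>Partitions and (skew) Young diagrams, English convention: cell (row, column),
  rows numbered downward from 0.\<close>
definition partition :: "nat list \<Rightarrow> bool" where
  "partition lam \<longleftrightarrow> sorted_wrt (\<ge>) lam \<and> 0 \<notin> set lam"

definition young :: "nat list \<Rightarrow> (nat \<times> nat) set" where
  "young lam = {(i,j). i < length lam \<and> j < lam ! i}"

definition skew_diagram :: "nat list \<Rightarrow> nat list \<Rightarrow> (nat \<times> nat) set" where
  "skew_diagram lam mu = young lam - young mu"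

definition skew_shape :: "nat list \<Rightarrow> nat list \<Rightarrow> nat \<Rightarrow> bool" where
  "skew_shape lam mu n \<longleftrightarrow> partition lam \<and> partition mu \<and> young mu \<subseteq> young lam
     \<and> card (skew_diagram lam mu) = n"

definition adjacent :: "nat \<times> nat \<Rightarrow> nat \<times> nat \<Rightarrow> bool" where
  "adjacent a b \<longleftrightarrow> (fst a = fst b \<and> (snd b = snd a + 1 \<or> snd a = snd b + 1))
     \<or> (snd a = snd b \<and> (fst b = fst a + 1 \<or> fst a = fst b + 1))"

definition connected_ribbon :: "(nat \<times> nat) set \<Rightarrow> bool" where
  "connected_ribbon D \<longleftrightarrow>
     (\<forall>a\<in>D. \<forall>b\<in>D. (\<lambda>u v. u \<in> D \<and> v \<in> D \<and> adjacent u v)\<^sup>*\<^sup>* a b)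
     \<and> \<not> (\<exists>i j. (i,j) \<in> D \<and> (i+1,j) \<in> D \<and> (i,j+1) \<in> D \<and> (i+1,j+1) \<in> D)"

definition SYT :: "(nat \<times> nat) set \<Rightarrow> nat \<Rightarrow> ((nat \<times> nat) \<Rightarrow> nat) set" where
  "SYT D n = {T. bij_betw T D {1..n} \<and> (\<forall>c. c \<notin> D \<longrightarrow> T c = 0) \<and>
     (\<forall>a\<in>D. \<forall>b\<in>D. fst a \<le> fst b \<and> snd a \<le> snd b \<and> a \<noteq> b \<longrightarrow> T a < T b)}"

definition syt_Des :: "(nat \<times> nat) set \<Rightarrow> nat \<Rightarrow> ((nat \<times> nat) \<Rightarrow> nat) \<Rightarrow> nat set" where
  "syt_Des D n T = {i \<in> {1..n-1}. fst (inv_into D T (i+1)) > fst (inv_into D T i)}"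

definition shift1 :: "nat \<Rightarrow> nat set \<Rightarrow> nat set" where
  "shift1 n S = (\<lambda>i. if i = n then 1 else i+1) ` S"

definition cyclic_descent_ext ::
  "(nat \<times> nat) set \<Rightarrow> nat \<Rightarrow> (((nat \<times> nat) \<Rightarrow> nat) \<Rightarrow> nat set)
     \<Rightarrow> (((nat \<times> nat) \<Rightarrow> nat) \<Rightarrow> ((nat \<times> nat) \<Rightarrow> nat)) \<Rightarrow> bool" where
  "cyclic_descent_ext D n cD psi \<longleftrightarrow> bij_betw psi (SYT D n) (SYT D n) \<and>
     (\<forall>T\<in>SYT D n. cD T \<subseteq> {1..n} \<and> cD T \<inter> {1..n-1} = syt_Des D n T
        \<and> cD (psi T) = shift1 n (cD T) \<and> cD T \<noteq> {} \<and> cD T \<noteq> {1..n})"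

text \<open>Cyclic Schur-positivity: a nonnegative integer combination (list with repetitions)
  of skew shapes with n cells that are not connected ribbons, each taken with a cyclic
  descent extension (the resulting sum is independent of that choice).\<close>
definition cyclic_schur_positive :: "nat \<Rightarrow> (nat \<Rightarrow> nat) set \<Rightarrow> bool" where
  "cyclic_schur_positive n A \<longleftrightarrow>
     (\<exists>L :: ((nat list \<times> nat list) \<times> (((nat \<times> nat) \<Rightarrow> nat) \<Rightarrow> nat set)) list.
        (\<forall>((lam, mu), cD) \<in> set L. skew_shape lam mu n
            \<and> \<not> connected_ribbon (skew_diagram lam mu)
            \<and> (\<exists>psi. cyclic_descent_ext (skew_diagram lam mu) n cD psi))
        \<and> (\<forall>x. genf (cDes n) A x =
              sum_list (map (\<lambda>((lam, mu), cD). genf cD (SYT (skew_diagram lam mu) n) x) L)))"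

end

theory Submission
  imports Defs "HOL-Library.Multiset" "HOL-Combinatorics.Cycles"
begin

text \<open>
  The class is matched with a single skew shape: the ribbon of \<open>J\<close> with one extra box placed
  strictly to its north-east.  Reading a tableau of this shape along the ribbon and then the box
  turns it into the inverse of a permutation \<open>\<rho>\<close> of \<open>[n]\<close> with prescribed descents
  of \<open>inv \<rho>\<close> inside \<open>[n-2]\<close>, and turns descents of the tableau into descents of \<open>\<rho>\<close>.

  By inclusion-exclusion over \<open>J\<close> and over descent sets it suffices to count permutations for
  which both sets are merely contained in given sets.  If \<open>n \<in> S\<close>, then \<open>S\<close> cuts the
  positions \<open>[n]\<close> into blocks; \<open>J\<close> cuts the values into runs, and permutations with inverse
  descents in \<open>J\<close> become words of fixed content by recording only the run of each value.  The permutations \<open>\<rho>\<close> with descents in \<open>S\<close> become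
  the words increasing on the blocks of \<open>S\<close>.  An element \<open>\<pi>\<close> of the rotated class becomes a
  word as well, after the letter at the position \<open>k\<close> of its largest value and the extra letter at
  position \<open>n\<close> are exchanged; \<open>\<pi>\<close> having cyclic descents in a rotation of \<open>S\<close> means
  that the word is increasing on blocks for an order in which the letters are cut at the letter
  of \<open>k\<close>.  Both kinds of words are determined by the multisets of letters on the blocks of \<open>S\<close>,
  and all such families of multisets occur.  Hence the counts agree for every rotation of
  \<open>S\<close>: the distribution of \<open>cDes\<close> on the class is invariant under rotation and its restriction
  to \<open>[n-1]\<close> is the distribution of \<open>Des\<close> on tableaux, so a cyclic descent extension can be
  transported from the class to the tableaux.
\<close>

declare One_nat_def [simp del]

section \<open>Arranging multisets of letters on blocks of positions\<close>

text \<open>If \<open>\<phi> (g x) < \<phi> (h x)\<close>, then all elements up to \<open>x\<close>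
  in the order \<open>r\<close> have rank at most \<open>\<phi> (g x)\<close> under
  \<open>g\<close>, while under \<open>h\<close> such ranks occur only strictly before
  \<open>x\<close>. Equal multisets give equal counts, a contradiction. Since \<open>\<phi>\<close>
  may identify letters, only ranks are compared.\<close>

lemma arrangement_unique:
  fixes r :: "'a \<Rightarrow> nat" and \<phi> :: "'b \<Rightarrow> nat"
  assumes fin: "finite X" and r: "inj_on r X"
    and eq: "image_mset g (mset_set X) = image_mset h (mset_set X)"
    and g: "\<And>x y. x \<in> X \<Longrightarrow> y \<in> X \<Longrightarrow> r x < r y \<Longrightarrow> \<phi> (g x) \<le> \<phi> (g y)"
    and h: "\<And>x y. x \<in> X \<Longrightarrow> y \<in> X \<Longrightarrow> r x < r y \<Longrightarrow> \<phi> (h x) \<le> \<phi> (h y)"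
    and x: "x \<in> X"
  shows "\<phi> (g x) = \<phi> (h x)"
proof -
  have card_eq: "card {y\<in>X. P (g y)} = card {y\<in>X. P (h y)}" for P
  proof -
    have "size (filter_mset P (image_mset k (mset_set X))) = card {y\<in>X. P (k y)}" for k
      using fin by (simp add: filter_mset_image_mset)
    then show ?thesis using eq by metis
  qed
  \<comment> \<open>The functions are generalized here because the argument is applied in both
    directions.\<close>
  have no: False
    if eqc: "\<And>P. card {y\<in>X. P (g y)} = card {y\<in>X. P (h y)}"
      and g: "\<And>x y. x \<in> X \<Longrightarrow> y \<in> X \<Longrightarrow> r x < r y \<Longrightarrow> \<phi> (g x) \<le> \<phi> (g y)"
      and h: "\<And>x y. x \<in> X \<Longrightarrow> y \<in> X \<Longrightarrow> r x < r y \<Longrightarrow> \<phi> (h x) \<le> \<phi> (h y)"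
      and lt: "\<phi> (g x) < \<phi> (h x)" for g h
  proof -
    have "{y\<in>X. r y \<le> r x} \<subseteq> {y\<in>X. \<phi> (g y) \<le> \<phi> (g x)}"
      using g x r by (fastforce simp: le_less inj_on_def)
    then have "card {y\<in>X. r y \<le> r x} \<le> card {y\<in>X. \<phi> (g y) \<le> \<phi> (g x)}"
      using fin by (intro card_mono) auto
    also have "\<dots> = card {y\<in>X. \<phi> (h y) \<le> \<phi> (g x)}" by (rule eqc)
    also have "\<dots> \<le> card {y\<in>X. r y < r x}"
    proof (intro card_mono)
      show "{y\<in>X. \<phi> (h y) \<le> \<phi> (g x)} \<subseteq> {y\<in>X. r y < r x}"
      proof safe
        fix y assume y: "y \<in> X" "\<phi> (h y) \<le> \<phi> (g x)"
        show "r y < r x"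
        proof (rule ccontr)
          assume "\<not> r y < r x"
          then have "y = x \<or> r x < r y" using r x y by (auto simp: inj_on_def not_less le_less)
          then show False using h[OF x y(1)] y lt by auto
        qed
      qed
    qed (use fin in auto)
    also have "\<dots> < card {y\<in>X. r y \<le> r x}"
      using fin x by (intro psubset_card_mono) auto
    finally show False by simp
  qed
  show ?thesis
  proof (rule antisym)
    show "\<phi> (g x) \<le> \<phi> (h x)"
      by (rule ccontr) (rule no[of h g], use card_eq g h in auto)
    show "\<phi> (h x) \<le> \<phi> (g x)"
      by (rule ccontr) (rule no[of g h], use card_eq g h in auto)
  qed
qed

lemma arrangement_exists:
  fixes r :: "'a \<Rightarrow> nat" and \<phi> :: "'b \<Rightarrow> nat"
  assumes fin: "finite X" and r: "inj_on r X"
  shows "\<exists>h. image_mset h (mset_set X) = image_mset g (mset_set X) \<and>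
    (\<forall>x\<in>X. \<forall>y\<in>X. r x < r y \<longrightarrow> \<phi> (h x) \<le> \<phi> (h y))"
proof -
  obtain l where l: "set l = X" "distinct l" using finite_distinct_list[OF fin] by blast
  define xs where "xs = sort_key r l"
  have xs: "set xs = X" "distinct xs" "sorted (map r xs)" using l by (auto simp: xs_def)
  then have mX: "mset_set X = mset xs" by (metis mset_set_set)
  define ys where "ys = sort_key \<phi> (map g xs)"
  have ys: "length ys = length xs" "sorted (map \<phi> ys)" "mset ys = image_mset g (mset xs)"
    by (auto simp: ys_def)
  define h where "h x = the (map_of (zip xs ys) x)" for x
  have h: "h (xs ! i) = ys ! i" if "i < length xs" for i
    using that ys(1) xs(2) by (simp add: h_def map_of_zip_nth)
  have "map h xs = ys" by (rule nth_equalityI) (auto simp: h ys)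
  then have "image_mset h (mset xs) = mset ys" by (metis mset_map)
  moreover have "\<phi> (h x) \<le> \<phi> (h y)" if xy: "x \<in> X" "y \<in> X" "r x < r y" for x y
  proof -
    obtain i j where ij: "i < length xs" "j < length xs" "x = xs ! i" "y = xs ! j"
      using xy xs(1) by (metis in_set_conv_nth)
    have "i < j"
    proof (rule ccontr)
      assume "\<not> i < j"
      then have "r y \<le> r x" using sorted_nth_mono[OF xs(3), of j i] ij by simp
      then show False using xy by simp
    qed
    then show ?thesis using sorted_nth_mono[OF ys(2), of i j] ij h ys(1) by simp
  qed
  ultimately show ?thesis using mX ys(3) by metis
qed

lemma image_mset_blocks_eqI:
  assumes fin: "finite X"
    and eq: "\<And>s. image_mset g (mset_set {x\<in>X. e x = s}) = image_mset h (mset_set {x\<in>X. e x = s})"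
  shows "image_mset g (mset_set X) = image_mset h (mset_set X)"
proof -
  have "finite A \<Longrightarrow> image_mset g (mset_set {x\<in>X. e x \<in> A}) = image_mset h (mset_set {x\<in>X. e x \<in> A})" for A
  proof (induction A rule: finite_induct)
    case (insert s A)
    have "{x\<in>X. e x \<in> insert s A} = {x\<in>X. e x = s} \<union> {x\<in>X. e x \<in> A}" by auto
    moreover have "{x\<in>X. e x = s} \<inter> {x\<in>X. e x \<in> A} = {}" using insert by auto
    ultimately have "mset_set {x\<in>X. e x \<in> insert s A} = mset_set {x\<in>X. e x = s} + mset_set {x\<in>X. e x \<in> A}"
      using fin by (simp add: mset_set_Union)
    then show ?case using insert eq by simp
  qed simp
  from this[of "e ` X"] show ?thesis using fin by (simp cong: conj_cong)
qed

text \<open>The rank \<open>\<phi>\<close> may depend on the block, because a cut orders the letters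
  differently on different blocks. Each block is arranged separately and the results are
  glued.\<close>

lemma block_arrangement_exists:
  fixes r :: "'a \<Rightarrow> nat" and \<phi> :: "'c \<Rightarrow> 'b \<Rightarrow> nat" and g :: "'a \<Rightarrow> 'b"
  assumes fin: "finite X" and r: "inj_on r X"
  obtains h where "\<And>s. image_mset h (mset_set {x\<in>X. e x = s}) = image_mset g (mset_set {x\<in>X. e x = s})"
    and "\<And>x y. x \<in> X \<Longrightarrow> y \<in> X \<Longrightarrow> e x = e y \<Longrightarrow> r x < r y \<Longrightarrow> \<phi> (e x) (h x) \<le> \<phi> (e x) (h y)"
proof -
  have "\<forall>s. \<exists>h. image_mset h (mset_set {x\<in>X. e x = s}) = image_mset g (mset_set {x\<in>X. e x = s}) \<and>
    (\<forall>x\<in>{x\<in>X. e x = s}. \<forall>y\<in>{x\<in>X. e x = s}. r x < r y \<longrightarrow> \<phi> s (h x) \<le> \<phi> s (h y))"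
    by (rule allI, rule arrangement_exists) (use fin r in \<open>auto intro: inj_on_subset\<close>)
  from choice[OF this] obtain H where H: "\<And>s. image_mset (H s) (mset_set {x\<in>X. e x = s}) = image_mset g (mset_set {x\<in>X. e x = s})"
    "\<And>s x y. \<lbrakk>x \<in> X; y \<in> X; e x = s; e y = s; r x < r y\<rbrakk> \<Longrightarrow> \<phi> s (H s x) \<le> \<phi> s (H s y)"
    by blast
  show ?thesis
  proof (rule that[of "\<lambda>x. H (e x) x"])
    fix s
    have "image_mset (\<lambda>x. H (e x) x) (mset_set {x\<in>X. e x = s}) = image_mset (H s) (mset_set {x\<in>X. e x = s})"
      by (rule image_mset_cong) (use fin in auto)
    then show "image_mset (\<lambda>x. H (e x) x) (mset_set {x\<in>X. e x = s}) = image_mset g (mset_set {x\<in>X. e x = s})"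
      using H(1) by simp
  qed (use H(2) in auto)
qed

section \<open>Words and permutations\<close>

text \<open>These are the rearrangements of \<open>q 1, ..., q n\<close>; the default 0 outside
  \<open>{1..n}\<close> makes equal words equal functions.\<close>

definition words :: "nat \<Rightarrow> (nat \<Rightarrow> nat) \<Rightarrow> (nat \<Rightarrow> nat) set" where
  "words n q = {f. (\<forall>x. x \<notin> {1..n} \<longrightarrow> f x = 0) \<and>
     image_mset f (mset_set {1..n}) = image_mset q (mset_set {1..n})}"

text \<open>For monotone \<open>q\<close> the level sets of \<open>q\<close> are runs of consecutive
  values, and the values of each run have to occur from left to right.\<close>

definition block_perms :: "nat \<Rightarrow> (nat \<Rightarrow> nat) \<Rightarrow> (nat \<Rightarrow> nat) set" where
  "block_perms n q = {\<rho>. \<rho> permutes {1..n} \<and>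
     (\<forall>i\<in>{1..<n}. q i = q (Suc i) \<longrightarrow> inv \<rho> i < inv \<rho> (Suc i))}"

definition word_of :: "nat \<Rightarrow> (nat \<Rightarrow> nat) \<Rightarrow> (nat \<Rightarrow> nat) \<Rightarrow> nat \<Rightarrow> nat" where
  "word_of n q \<rho> x = (if x \<in> {1..n} then q (\<rho> x) else 0)"

lemma word_of_in_words:
  assumes "\<rho> permutes {1..n}" shows "word_of n q \<rho> \<in> words n q"
proof -
  have "image_mset (word_of n q \<rho>) (mset_set {1..n}) = image_mset q (image_mset \<rho> (mset_set {1..n}))"
    unfolding multiset.map_comp by (rule image_mset_cong) (auto simp: word_of_def)
  also have "image_mset \<rho> (mset_set {1..n}) = mset_set {1..n}"
    using assms by (simp add: image_mset_mset_set permutes_inj_on permutes_image)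
  finally show ?thesis by (simp add: words_def) (auto simp: word_of_def)
qed

lemma words_comp_permutes:
  assumes "f \<in> words n q" "p permutes {1..n}" shows "f \<circ> p \<in> words n q"
proof -
  have "image_mset (f \<circ> p) (mset_set {1..n}) = image_mset f (image_mset p (mset_set {1..n}))"
    by (simp add: multiset.map_comp)
  also have "image_mset p (mset_set {1..n}) = mset_set {1..n}"
    using assms by (simp add: image_mset_mset_set permutes_inj_on permutes_image)
  finally have "image_mset (f \<circ> p) (mset_set {1..n}) = image_mset q (mset_set {1..n})"
    using assms(1) by (simp only: words_def mem_Collect_eq)
  then show ?thesis using assms(1) permutes_not_in[OF assms(2)] by (simp only: words_def mem_Collect_eq) auto
qed

lemma chain_induct:
  assumes "x < (y::nat)" "\<And>w. x \<le> w \<Longrightarrow> w < y \<Longrightarrow> P w (Suc w)"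
    and "\<And>a b c. P a b \<Longrightarrow> P b c \<Longrightarrow> P a c"
  shows "P x y"
  using assms(1,2)
proof (induction y)
  case (Suc y)
  show ?case
  proof (cases "x = y")
    case False
    then have "P x y" using Suc by auto
    then show ?thesis using Suc.prems assms(3) by (metis less_Suc_eq_le lessI)
  qed (use Suc in auto)
qed simp

text \<open>This is the rule of standardization: different runs are ordered by their letters, and
  within one run larger values stand further to the right.\<close>

lemma block_perms_less_iff:
  assumes q: "mono_on {1..n} q" and \<rho>: "\<rho> \<in> block_perms n q" and xy: "x \<in> {1..n}" "y \<in> {1..n}"
  shows "\<rho> x < \<rho> y \<longleftrightarrow> q (\<rho> x) < q (\<rho> y) \<or> q (\<rho> x) = q (\<rho> y) \<and> x < y"
proof -
  have p: "\<rho> permutes {1..n}" using \<rho> by (simp add: block_perms_def)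
  have *: "q (\<rho> x) < q (\<rho> y) \<or> q (\<rho> x) = q (\<rho> y) \<and> x < y"
    if lt: "\<rho> x < \<rho> y" and xy: "x \<in> {1..n}" "y \<in> {1..n}" for x y
  proof -
    have r: "\<rho> x \<in> {1..n}" "\<rho> y \<in> {1..n}" using permutes_in_image[OF p] xy by auto
    have "x < y" if eq: "q (\<rho> x) = q (\<rho> y)"
    proof -
      have "inv \<rho> (\<rho> x) < inv \<rho> (\<rho> y)"
      proof (rule chain_induct[OF lt])
        fix w assume w: "\<rho> x \<le> w" "w < \<rho> y"
        have "q (\<rho> x) \<le> q w" "q w \<le> q (Suc w)" "q (Suc w) \<le> q (\<rho> y)"
          using w r by (auto intro!: mono_onD[OF q])
        then show "inv \<rho> w < inv \<rho> (Suc w)" using eq w r \<rho> by (auto simp: block_perms_def)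
      qed auto
      then show "x < y" using permutes_inverses[OF p] by simp
    qed
    moreover have "q (\<rho> x) \<le> q (\<rho> y)" using lt r by (auto intro!: mono_onD[OF q])
    ultimately show ?thesis by linarith
  qed
  have "\<rho> x = \<rho> y \<longleftrightarrow> x = y" using permutes_inj[OF p] by (auto dest: injD)
  then show ?thesis using *[of x y] *[of y x] xy by (cases "\<rho> x" "\<rho> y" rule: linorder_cases) auto
qed

text \<open>Each value is one more than the number of smaller values, so the comparisons determine
  the permutation.\<close>

lemma permutes_eqI_order:
  assumes p: "p permutes {1..n}" and p': "p' permutes {1..n}"
    and eq: "\<And>x y::nat. x \<in> {1..n} \<Longrightarrow> y \<in> {1..n} \<Longrightarrow> p x < p y \<longleftrightarrow> p' x < p' y"
  shows "p = p'"
proof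
  fix x
  show "p x = p' x"
  proof (cases "x \<in> {1..n}")
    case True
    have r: "p x = Suc (card {y\<in>{1..n}. p y < p x})" if p: "p permutes {1..n}" for p :: "nat \<Rightarrow> nat"
    proof -
      have "p ` {y\<in>{1..n}. p y < p x} = {1..<p x}"
      proof
        show "{1..<p x} \<subseteq> p ` {y\<in>{1..n}. p y < p x}"
        proof
          fix v assume v: "v \<in> {1..<p x}"
          moreover have "p x \<in> {1..n}" using permutes_in_image[OF p] True by simp
          ultimately have "v \<in> {1..n}" by auto
          then have "inv p v \<in> {1..n}" "p (inv p v) = v"
            using permutes_in_image[OF permutes_inv[OF p]] permutes_inverses[OF p] by auto
          then show "v \<in> p ` {y\<in>{1..n}. p y < p x}" using v by (intro image_eqI[of _ _ "inv p v"]) auto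
        qed
        show "p ` {y\<in>{1..n}. p y < p x} \<subseteq> {1..<p x}"
        proof
          fix v assume "v \<in> p ` {y\<in>{1..n}. p y < p x}"
          then obtain y where y: "y \<in> {1..n}" "p y < p x" "v = p y" by auto
          then have "p y \<in> {1..n}" using permutes_in_image[OF p, of y] by simp
          then show "v \<in> {1..<p x}" using y by simp
        qed
      qed
      then have "card {y\<in>{1..n}. p y < p x} = p x - 1"
        using card_image[of p "{y\<in>{1..n}. p y < p x}"] permutes_inj_on[OF p] by simp
      moreover have "p x \<in> {1..n}" using permutes_in_image[OF p] True by simp
      ultimately show ?thesis by auto
    qed
    have "{y\<in>{1..n}. p y < p x} = {y\<in>{1..n}. p' y < p' x}" using eq True by auto
    then show ?thesis using r[OF p] r[OF p'] by simp
  next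
    case False
    then show ?thesis using permutes_not_in[OF p] permutes_not_in[OF p'] by simp
  qed
qed

lemma order_permutation_exists:
  fixes key :: "nat \<Rightarrow> nat"
  assumes "inj_on key {1..n}"
  obtains p where "p permutes {1..n}" "\<And>x y. x \<in> {1..n} \<Longrightarrow> y \<in> {1..n} \<Longrightarrow> p x < p y \<longleftrightarrow> key x < key y"
proof -
  define p where "p x = (if x \<in> {1..n} then card {y\<in>{1..n}. key y \<le> key x} else x)" for x
  have lt: "p x < p y" if "x \<in> {1..n}" "y \<in> {1..n}" "key x < key y" for x y
  proof -
    have "card {z\<in>{1..n}. key z \<le> key x} < card {z\<in>{1..n}. key z \<le> key y}"
    proof (rule psubset_card_mono)
      show "{z\<in>{1..n}. key z \<le> key x} \<subset> {z\<in>{1..n}. key z \<le> key y}"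
      proof
        show "{z\<in>{1..n}. key z \<le> key x} \<subseteq> {z\<in>{1..n}. key z \<le> key y}" using that by auto
        have "y \<in> {z\<in>{1..n}. key z \<le> key y}" "y \<notin> {z\<in>{1..n}. key z \<le> key x}" using that by auto
        then show "{z\<in>{1..n}. key z \<le> key x} \<noteq> {z\<in>{1..n}. key z \<le> key y}" by metis
      qed
    qed simp
    then show ?thesis using that by (auto simp: p_def)
  qed
  have iff: "p x < p y \<longleftrightarrow> key x < key y" if xy: "x \<in> {1..n}" "y \<in> {1..n}" for x y
  proof (cases "key x" "key y" rule: linorder_cases)
    case less
    then show ?thesis using lt[OF xy] by simp
  next
    case equal
    then have "x = y" using inj_onD[OF assms _ xy] by blast
    then show ?thesis by simp
  next
    case greater
    then show ?thesis using lt[OF xy(2,1)] by simp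
  qed
  have inj: "inj_on p {1..n}"
  proof (rule inj_onI)
    fix x y assume xy: "x \<in> {1..n}" "y \<in> {1..n}" "p x = p y"
    then have "key x = key y" using iff[of x y] iff[of y x] by (metis nat_neq_iff)
    then show "x = y" using inj_onD[OF assms _ xy(1,2)] by blast
  qed
  have "p ` {1..n} \<subseteq> {1..n}"
  proof safe
    fix x assume x: "x \<in> {1..n}"
    have "card {y\<in>{1..n}. key y \<le> key x} \<le> card {1..n}" by (intro card_mono) auto
    moreover have "0 < card {y\<in>{1..n}. key y \<le> key x}" using x by (auto simp: card_gt_0_iff)
    ultimately show "p x \<in> {1..n}" using x by (auto simp: p_def)
  qed
  then have "bij_betw p {1..n} {1..n}" using inj
    by (simp add: bij_betw_def endo_inj_surj)
  then have "p permutes {1..n}" by (rule bij_imp_permutes) (auto simp: p_def)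
  then show ?thesis using that iff by blast
qed

text \<open>The inverse map is standardization: number the positions by letter first and from left
  to right among equal letters.\<close>

lemma block_perms_words_bij:
  assumes q: "mono_on {1..n} q"
  shows "bij_betw (word_of n q) (block_perms n q) (words n q)"
proof (rule bij_betwI')
  fix \<rho> \<rho>' assume r: "\<rho> \<in> block_perms n q" "\<rho>' \<in> block_perms n q"
  show "word_of n q \<rho> = word_of n q \<rho>' \<longleftrightarrow> \<rho> = \<rho>'"
  proof
    assume eq: "word_of n q \<rho> = word_of n q \<rho>'"
    have e: "q (\<rho> x) = q (\<rho>' x)" if "x \<in> {1..n}" for x
      using fun_cong[OF eq, of x] that by (simp add: word_of_def)
    show "\<rho> = \<rho>'"
      by (rule permutes_eqI_order[of _ n])
        (use r e in \<open>auto simp: block_perms_less_iff[OF q] , auto simp: block_perms_def\<close>)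
  qed simp
next
  fix \<rho> assume "\<rho> \<in> block_perms n q"
  then show "word_of n q \<rho> \<in> words n q" by (auto simp: block_perms_def intro: word_of_in_words)
next
  fix f assume f: "f \<in> words n q"
  \<comment> \<open>The lexicographic order on (letter, position) is coded in one number; the factor
    \<open>Suc n\<close> exceeds every difference of positions in \<open>{1..n}\<close>.\<close>
  define key where "key x = f x * Suc n + x" for x
  have key: "key x < key y \<longleftrightarrow> f x < f y \<or> f x = f y \<and> x < y" if "x \<in> {1..n}" "y \<in> {1..n}" for x y
  proof (cases "f x" "f y" rule: linorder_cases)
    case less
    then have "Suc (f x) * Suc n \<le> f y * Suc n" by (intro mult_le_mono1) auto
    then show ?thesis using less that by (auto simp: key_def)
  next
    case greater
    then have "Suc (f y) * Suc n \<le> f x * Suc n" by (intro mult_le_mono1) auto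
    then show ?thesis using greater that by (auto simp: key_def)
  qed (simp add: key_def)
  have "inj_on key {1..n}"
  proof (rule inj_onI)
    fix x y assume "x \<in> {1..n}" "y \<in> {1..n}" "key x = key y"
    then show "x = y" using key[of x y] key[of y x] by auto
  qed
  then obtain p where p: "p permutes {1..n}"
    and pk: "\<And>x y. x \<in> {1..n} \<Longrightarrow> y \<in> {1..n} \<Longrightarrow> p x < p y \<longleftrightarrow> key x < key y"
    by (rule order_permutation_exists) blast
  have ip: "inv p permutes {1..n}" by (rule permutes_inv[OF p])
  have im: "inv p i \<in> {1..n}" "p (inv p i) = i" if "i \<in> {1..n}" for i
    using permutes_in_image[OF ip] permutes_inverses[OF p] that by auto
  have fq: "f (inv p i) = q i" if i: "i \<in> {1..n}" for i
  proof -
    \<comment> \<open>Read in the order of \<open>p\<close>, the letters of \<open>f\<close>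
      increase weakly, as do those of \<open>q\<close>; two increasing arrangements of one multiset
      coincide.\<close>
    have "(\<lambda>x. x) ((f \<circ> inv p) i) = (\<lambda>x. x) (q i)"
    proof (rule arrangement_unique[where X = "{1..n}" and r = "\<lambda>x. x" and \<phi> = "\<lambda>x. x"
            and g = "f \<circ> inv p" and h = q])
      show "image_mset (f \<circ> inv p) (mset_set {1..n}) = image_mset q (mset_set {1..n})"
        using words_comp_permutes[OF f ip] by (simp add: words_def)
      fix x y :: nat assume xy: "x \<in> {1..n}" "y \<in> {1..n}" "x < y"
      then have "key (inv p x) < key (inv p y)" using pk[of "inv p x" "inv p y"] im by metis
      then show "(f \<circ> inv p) x \<le> (f \<circ> inv p) y" using key im xy by auto
      show "q x \<le> q y" using xy by (intro mono_onD[OF q]) auto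
    qed (use i in auto)
    then show ?thesis by simp
  qed
  have "f = word_of n q p"
  proof
    fix x
    show "f x = word_of n q p x"
    proof (cases "x \<in> {1..n}")
      case True
      then have "p x \<in> {1..n}" using permutes_in_image[OF p] by simp
      then show ?thesis using fq[of "p x"] permutes_inverses[OF p] True by (simp add: word_of_def)
    next
      case False
      then show ?thesis using f by (auto simp: words_def word_of_def)
    qed
  qed
  moreover have "p \<in> block_perms n q"
  proof -
    have "inv p i < inv p (Suc i)" if i: "i \<in> {1..<n}" "q i = q (Suc i)" for i
    proof -
      have "key (inv p i) < key (inv p (Suc i))" using pk[of "inv p i" "inv p (Suc i)"] im i by auto
      then show ?thesis using key[of "inv p i" "inv p (Suc i)"] im i fq[of i] fq[of "Suc i"] by auto
    qed
    then show ?thesis using p by (auto simp: block_perms_def)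
  qed
  ultimately show "\<exists>\<rho>\<in>block_perms n q. f = word_of n q \<rho>" by blast
qed

section \<open>Words sorted on the blocks of a cut\<close>

text \<open>For \<open>r\<close> and \<open>z\<close> in \<open>{1..n}\<close> this is
  \<open>z - r\<close> modulo \<open>n\<close> with representatives in \<open>{1..n}\<close>, so
  that \<open>z = r\<close> gives \<open>n\<close>.\<close>

definition rotate_back :: "nat \<Rightarrow> nat \<Rightarrow> nat \<Rightarrow> nat" where
  "rotate_back n r z = (if r < z then z - r else z + n - r)"

text \<open>Positions cut into blocks by \<open>S\<close> are rotated by \<open>z0\<close>, and
  \<open>z0\<close> itself is sent to \<open>n\<close>. By \<open>q_less\<close> the letter
  \<open>q n\<close> occurs once in every word, so its place can carry information.\<close>

locale cut_words =
  fixes n :: nat and S :: "nat set" and z0 :: nat and q :: "nat \<Rightarrow> nat"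
  assumes n_in_S: "n \<in> S" and S_subset: "S \<subseteq> {1..n}" and z0: "z0 \<in> {1..n}"
    and q_less: "\<And>i. i \<in> {1..<n} \<Longrightarrow> q i < q n"
begin

definition block_end :: "nat \<Rightarrow> nat" where "block_end z = (LEAST s. s \<in> S \<and> z \<le> s)"

abbreviation rotate :: "nat \<Rightarrow> nat" where "rotate \<equiv> rotate_back n z0"

text \<open>Positions are ordered by letter and, for equal letters, by rotated position. The ones up
  to and including \<open>k\<close> are those whose values a rotation with maximum at
  \<open>k\<close> moves to the top.\<close>

definition upper :: "(nat \<Rightarrow> nat) \<Rightarrow> nat \<Rightarrow> nat \<Rightarrow> bool" where
  "upper f k z \<longleftrightarrow> f z < f k \<or> f z = f k \<and> rotate z \<le> rotate k"

text \<open>The linear order just described is cut after \<open>k\<close> and its lower part is put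
  above the rest, so that \<open>k\<close> becomes the maximum.\<close>

definition cut_less :: "(nat \<Rightarrow> nat) \<Rightarrow> nat \<Rightarrow> nat \<Rightarrow> nat \<Rightarrow> bool" where
  "cut_less f k z y \<longleftrightarrow> \<not> upper f k z \<and> upper f k y \<or>
     (upper f k z \<longleftrightarrow> upper f k y) \<and> (f z < f y \<or> f z = f y \<and> rotate z < rotate y)"

definition sorted_words :: "(nat \<Rightarrow> nat) set" where
  "sorted_words = {g \<in> words n q. \<forall>z\<in>{1..n}-S. g z \<le> g (Suc z)}"

text \<open>In \<open>g\<close> the letter \<open>q n\<close> marks the position \<open>k\<close> of
  the largest value of the rotated permutation. Transposing returns this letter to
  \<open>z0\<close>, where the unrotated permutation has its fixed value \<open>n\<close>; the cut
  order refers to that word.\<close>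

definition cut_sorted_words :: "(nat \<Rightarrow> nat) set" where
  "cut_sorted_words = {g \<in> words n q. \<exists>k\<in>{1..n}. g k = q n \<and>
     (\<forall>z\<in>{1..n}-S. cut_less (g \<circ> transpose k z0) k z (Suc z))}"

abbreviation block :: "nat \<Rightarrow> nat set" where "block s \<equiv> {x\<in>{1..n}. block_end x = s}"

definition block_msets :: "(nat \<Rightarrow> nat) \<Rightarrow> nat \<Rightarrow> nat multiset" where
  "block_msets g s = image_mset g (mset_set (block s))"

lemma block_end:
  assumes "z \<in> {1..n}"
  shows "block_end z \<in> S" "z \<le> block_end z" "block_end z \<in> {1..n}"
proof -
  have "block_end z \<in> S \<and> z \<le> block_end z"
    unfolding block_end_def by (rule LeastI[of _ n]) (use assms n_in_S in auto)
  then show "block_end z \<in> S" "z \<le> block_end z" "block_end z \<in> {1..n}" using S_subset by auto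
qed

lemma block_end_le: "s \<in> S \<Longrightarrow> z \<le> s \<Longrightarrow> block_end z \<le> s"
  unfolding block_end_def by (rule Least_le) simp

lemma block_end_in_S: "s \<in> S \<Longrightarrow> block_end s = s"
  using block_end_le[of s s] block_end(2)[of s] S_subset by fastforce

lemma block_end_mono: "x \<le> y \<Longrightarrow> y \<in> {1..n} \<Longrightarrow> block_end x \<le> block_end y"
  using block_end[of y] block_end_le[of "block_end y" x] by auto

lemma block_end_Suc: "z \<in> {1..n} - S \<Longrightarrow> z < n \<and> Suc z \<in> {1..n} \<and> block_end (Suc z) = block_end z"
proof -
  assume z: "z \<in> {1..n} - S"
  then have "z \<noteq> n" using n_in_S by auto
  then have zn: "z < n" "Suc z \<in> {1..n}" using z by auto
  have "block_end z \<noteq> z" using z block_end(1)[of z] by auto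
  then have "Suc z \<le> block_end z" using block_end(2)[of z] z by auto
  then have "block_end (Suc z) \<le> block_end z" using block_end(1)[of z] z by (intro block_end_le) auto
  moreover have "block_end z \<le> block_end (Suc z)" using zn by (intro block_end_mono) auto
  ultimately show ?thesis using zn by auto
qed

lemma block_interior:
  assumes "x \<in> {1..n}" "y \<in> {1..n}" "block_end x = block_end y" "x \<le> w" "w < y"
  shows "w \<in> {1..n} - S"
proof -
  have "w \<notin> S"
  proof
    assume "w \<in> S"
    then have "block_end x \<le> w" using assms by (intro block_end_le)
    then show False using assms block_end(2)[of y] by simp
  qed
  then show ?thesis using assms by auto
qed

lemma block_chain:
  assumes "x \<in> {1..n}" "y \<in> {1..n}" "block_end x = block_end y" "x < y"
    and "\<And>z. z \<in> {1..n} - S \<Longrightarrow> P z (Suc z)" "\<And>a b c. P a b \<Longrightarrow> P b c \<Longrightarrow> P a c"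
  shows "P x y"
  by (rule chain_induct[where P = P]) (use assms block_interior in \<open>blast+\<close>)

lemma cut_less_trans: "cut_less f k a b \<Longrightarrow> cut_less f k b c \<Longrightarrow> cut_less f k a c"
  unfolding cut_less_def by (elim disjE conjE) auto

lemma words_le: "g \<in> words n q \<Longrightarrow> x \<in> {1..n} \<Longrightarrow> g x \<le> q n"
proof -
  assume g: "g \<in> words n q" and x: "x \<in> {1..n}"
  have "g x \<in># image_mset g (mset_set {1..n})" using x by simp
  also have "image_mset g (mset_set {1..n}) = image_mset q (mset_set {1..n})" using g by (simp add: words_def)
  finally obtain i where "i \<in> {1..n}" "g x = q i" by auto
  then show ?thesis using q_less[of i] by (cases "i = n") auto
qed

lemma words_top: "g \<in> words n q \<Longrightarrow> \<exists>!k. k \<in> {1..n} \<and> g k = q n"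
proof -
  assume g: "g \<in> words n q"
  have "size (filter_mset (\<lambda>b. b = q n) (image_mset h (mset_set {1..n}))) = card {x\<in>{1..n}. h x = q n}" for h
    by (simp add: filter_mset_image_mset)
  from this[of g] this[of q] have "card {x\<in>{1..n}. g x = q n} = card {x\<in>{1..n}. q x = q n}"
    using g by (simp only: words_def mem_Collect_eq)
  also have "{x\<in>{1..n}. q x = q n} = {n}"
  proof -
    have "x = n" if "x \<in> {1..n}" "q x = q n" for x
      using q_less[of x] that by (cases "x = n") simp_all
    then show ?thesis using z0 by (auto simp del: One_nat_def)
  qed
  finally have "card {x\<in>{1..n}. g x = q n} = 1" by simp
  then obtain k where "{x\<in>{1..n}. g x = q n} = {k}" by (rule card_1_singletonE)
  then have "x \<in> {1..n} \<and> g x = q n \<longleftrightarrow> x = k" for x by blast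
  then show ?thesis by (intro ex1I[of _ k]) blast+
qed

lemma words_block_msets:
  assumes "g \<in> words n q" "\<And>x. x \<notin> {1..n} \<Longrightarrow> h x = 0" "block_msets h = block_msets g"
  shows "h \<in> words n q"
proof -
  have "image_mset h (mset_set {1..n}) = image_mset g (mset_set {1..n})"
    by (rule image_mset_blocks_eqI[of _ _ block_end])
      (use assms(3) in \<open>auto simp: block_msets_def fun_eq_iff\<close>)
  then show ?thesis using assms by (simp add: words_def)
qed

lemma block_msets_eqD:
  assumes "block_msets h = block_msets g" "x \<in> {1..n}"
  shows "\<exists>y\<in>{1..n}. block_end y = block_end x \<and> h y = g x"
proof -
  have "g x \<in># block_msets g (block_end x)" using assms by (simp add: block_msets_def)
  then have "g x \<in># block_msets h (block_end x)" using assms by simp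
  then show ?thesis by (auto simp: block_msets_def)
qed

section \<open>Sorted words and their block multisets\<close>

lemma sorted_wordsD:
  assumes "g \<in> sorted_words" "x \<in> {1..n}" "y \<in> {1..n}" "block_end x = block_end y" "x < y"
  shows "g x \<le> g y"
  using assms(2-5)
proof (rule block_chain[where P = "\<lambda>x y. g x \<le> g y"])
  show "g z \<le> g (Suc z)" if "z \<in> {1..n} - S" for z
    using assms(1) that by (simp add: sorted_words_def)
qed (rule order_trans)

lemma inj_on_sorted_words: "inj_on block_msets sorted_words"
proof (rule inj_onI)
  fix g h assume gh: "g \<in> sorted_words" "h \<in> sorted_words" "block_msets g = block_msets h"
  show "g = h"
  proof
    fix x
    show "g x = h x"
    proof (cases "x \<in> {1..n}")
      case True
      show ?thesis
        by (rule arrangement_unique[where X = "block (block_end x)" and r = "\<lambda>x. x" and \<phi> = "\<lambda>x. x"])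
          (use gh True in \<open>auto simp: block_msets_def fun_eq_iff intro: sorted_wordsD\<close>)
    next
      case False
      then show ?thesis using gh by (simp add: sorted_words_def words_def)
    qed
  qed
qed

lemma sorted_words_surj:
  assumes g: "g \<in> words n q"
  shows "\<exists>h\<in>sorted_words. block_msets h = block_msets g"
proof -
  obtain h where h: "\<And>s. image_mset h (mset_set (block s)) = image_mset g (mset_set (block s))"
    "\<And>x y. x \<in> {1..n} \<Longrightarrow> y \<in> {1..n} \<Longrightarrow> block_end x = block_end y \<Longrightarrow> x < y \<Longrightarrow> h x \<le> h y"
    by (rule block_arrangement_exists[of "{1..n}" "\<lambda>x. x" block_end g "\<lambda>s x. x"]) auto
  define h' where "h' x = (if x \<in> {1..n} then h x else 0)" for x
  have "image_mset h' (mset_set (block s)) = image_mset h (mset_set (block s))" for s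
    by (rule image_mset_cong) (auto simp: h'_def)
  then have eq: "block_msets h' = block_msets g" using h(1) by (auto simp: block_msets_def)
  have "h' \<in> words n q" by (rule words_block_msets[OF g _ eq]) (auto simp: h'_def)
  moreover have "h' z \<le> h' (Suc z)" if "z \<in> {1..n} - S" for z
    using block_end_Suc[OF that] h(2)[of z "Suc z"] that by (simp add: h'_def)
  ultimately show ?thesis using eq by (auto simp: sorted_words_def)
qed

text \<open>The order of positions in which a cut-sorted word is weakly increasing on the block of
  \<open>z0\<close>, when \<open>k\<close> is the position of the largest letter.\<close>

definition pos :: "nat \<Rightarrow> nat \<Rightarrow> nat" where
  "pos k z = (if z = k then 3 * n else if z0 < z then z else if z = z0 then n + 1 else n + 1 + z)"

text \<open>The order of letters in which a cut-sorted word is weakly increasing on the block ending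
  in \<open>s\<close>, for blocks not containing \<open>z0\<close>: the letters below the cut \<open>b\<close> move to the top.\<close>

definition letter_rank :: "nat \<Rightarrow> nat \<Rightarrow> nat \<Rightarrow> nat \<Rightarrow> nat" where
  "letter_rank k b s l = (if l = q n then 3 * q n + 1
     else if l < b \<or> l = b \<and> rotate s \<le> rotate k then l + q n else l)"

section \<open>Cut-sorted words are determined by their block multisets\<close>

lemma inj_pos: "inj_on (pos k) {1..n}"
proof (rule inj_onI)
  fix x y assume "x \<in> {1..n}" "y \<in> {1..n}" "pos k x = pos k y"
  then show "x = y" using z0 by (simp add: pos_def split: if_splits)
qed

lemma letter_rank_inj:
  assumes "l \<le> q n" "l' \<le> q n" "letter_rank k b s l = letter_rank k b s l'"
  shows "l = l'"
  using assms by (auto simp: letter_rank_def split: if_splits)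

text \<open>Rotation breaks up only the block of \<open>z0\<close>. Any other block stays
  contiguous, and \<open>k\<close>, being a block end, does not separate it; so breaking ties
  against \<open>k\<close> depends on the block alone.\<close>

lemma rotate_block:
  assumes x: "x \<in> {1..n}" "x \<noteq> k" "block_end x \<noteq> block_end z0" and k: "k \<in> S"
  shows "rotate x \<le> rotate k \<longleftrightarrow> rotate (block_end x) \<le> rotate k"
proof -
  have s: "x \<le> block_end x" "block_end x \<in> {1..n}" "k \<in> {1..n}" using block_end x k S_subset by auto
  have side: "block_end x < z0 \<or> z0 < x"
  proof (rule ccontr)
    assume "\<not> ?thesis"
    then have a: "x \<le> z0" "z0 \<le> block_end x" by auto
    have "block_end z0 \<le> block_end x" using a block_end(1)[OF x(1)] by (intro block_end_le) auto
    moreover have "block_end x \<le> block_end z0" using a z0 by (intro block_end_mono) auto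
    ultimately show False using x by simp
  qed
  have "k < x \<or> block_end x \<le> k" using block_end_le[OF k, of x] by linarith
  then show ?thesis using side s x(1,2) z0 by (auto simp: rotate_back_def)
qed

context
  fixes g k
  assumes g: "g \<in> words n q" and k: "k \<in> {1..n}" "g k = q n"
begin

lemma not_top_less: "x \<in> {1..n} \<Longrightarrow> x \<noteq> k \<Longrightarrow> g x < q n"
  using words_le[OF g] words_top[OF g] k by (metis le_neq_implies_less)

lemma swap_eq:
  "(g \<circ> transpose k z0) z0 = q n" "(g \<circ> transpose k z0) k = g z0"
  "x \<noteq> k \<Longrightarrow> x \<noteq> z0 \<Longrightarrow> (g \<circ> transpose k z0) x = g x"
  using k by (simp_all add: transpose_def)

text \<open>After the swap \<open>z0\<close> carries the top letter, which is larger than the letter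
  at \<open>k\<close> unless both positions coincide.\<close>

lemma upper_z0: "upper (g \<circ> transpose k z0) k z0 \<longleftrightarrow> k = z0"
proof (cases "k = z0")
  case False
  then have "g z0 < q n" using not_top_less z0 by auto
  then show ?thesis using False unfolding upper_def swap_eq by simp
qed (simp add: upper_def)

lemma upper_k: "upper (g \<circ> transpose k z0) k k"
  by (simp add: upper_def)

lemma upper_other:
  "x \<noteq> k \<Longrightarrow> x \<noteq> z0 \<Longrightarrow> upper (g \<circ> transpose k z0) k x \<longleftrightarrow> g x < g z0 \<or> g x = g z0 \<and> rotate x \<le> rotate k"
  unfolding upper_def swap_eq(2) by (simp add: swap_eq(3))

context
  assumes less: "\<And>z. z \<in> {1..n} - S \<Longrightarrow> cut_less (g \<circ> transpose k z0) k z (Suc z)"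
begin

text \<open>The position \<open>k\<close> is the maximum of the cut order, so nothing can follow it
  inside its block.\<close>

lemma top_in_S: "k \<in> S"
proof (rule ccontr)
  assume "k \<notin> S"
  then have "cut_less (g \<circ> transpose k z0) k k (Suc k)" using less k by auto
  then show False using upper_k by (auto simp: cut_less_def upper_def)
qed

lemma less_in_block:
  assumes "x \<in> {1..n}" "y \<in> {1..n}" "block_end x = block_end y" "x < y"
  shows "cut_less (g \<circ> transpose k z0) k x y"
  by (rule block_chain[where P = "cut_less (g \<circ> transpose k z0) k", OF assms less cut_less_trans])

text \<open>Let \<open>k \<noteq> z0\<close>. With the top letter at \<open>z0\<close> and
  \<open>z0\<close> not \<open>upper\<close>, the earlier positions of the block are not
  \<open>upper\<close> and the later ones are. Apart from \<open>k\<close>, the former thus have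
  letters at least \<open>g z0\<close> and the latter at most \<open>g z0\<close>. This is why
  \<open>pos\<close> lists the later positions, then \<open>z0\<close>, then the earlier ones, and
  \<open>k\<close> last.\<close>

lemma sorted_z0_block:
  assumes xy: "x \<in> {1..n}" "y \<in> {1..n}" "block_end x = block_end z0" "block_end y = block_end z0"
    and lt: "pos k x < pos k y"
  shows "g x \<le> g y"
proof (cases "y = k \<or> x = k")
  case True
  then show ?thesis using words_le[OF g xy(1)] k lt xy z0 by (auto simp: pos_def split: if_splits)
next
  case False
  note lb = less_in_block
  have gz: "g w \<le> q n" if "w \<in> {1..n}" for w using words_le[OF g that] .
  show ?thesis
  proof (cases "k = z0")
    case True
    \<comment> \<open>If \<open>k = z0\<close>, the block ends at \<open>z0\<close>; all its other
      positions have letters below the top letter and are \<open>upper\<close>, so no letters change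
      sides.\<close>
    have le: "w \<le> z0" if "w \<in> {1..n}" "block_end w = block_end z0" for w
      using block_end(2)[OF that(1)] that(2) block_end_in_S[OF top_in_S] True by simp
    have "x < z0" "y < z0" using le xy False True by (auto simp: le_less)
    then have lt': "x < y" using lt False True by (simp add: pos_def)
    have "g x < g z0" "g y < g z0" using not_top_less[of x] not_top_less[of y] xy False k True by auto
    then have "upper (g \<circ> transpose k z0) k x" "upper (g \<circ> transpose k z0) k y"
      using upper_other[of x] upper_other[of y] False True by blast+
    moreover have "cut_less (g \<circ> transpose k z0) k x y" using lb[OF xy(1,2) _ lt'] xy by simp
    ultimately have "(g \<circ> transpose k z0) x \<le> (g \<circ> transpose k z0) y"
      by (simp only: cut_less_def simp_thms) linarith
    then show ?thesis using swap_eq(3)[of x] swap_eq(3)[of y] False True by simp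
  next
    case kz: False
    have hi: "upper (g \<circ> transpose k z0) k w" if w: "w \<in> {1..n}" "block_end w = block_end z0" "z0 < w" "w \<noteq> k" for w
    proof -
      have "cut_less (g \<circ> transpose k z0) k z0 w" using lb[OF z0 w(1) _ w(3)] w(2) by simp
      moreover have "\<not> upper (g \<circ> transpose k z0) k z0" using upper_z0 kz by simp
      moreover have "(g \<circ> transpose k z0) w = g w" using swap_eq(3)[of w] w by simp
      moreover have "\<not> rotate z0 < rotate w" using w z0 by (simp add: rotate_back_def)
      ultimately show ?thesis using gz[OF w(1)] swap_eq(1) unfolding cut_less_def by linarith
    qed
    have lo: "\<not> upper (g \<circ> transpose k z0) k w" if w: "w \<in> {1..n}" "block_end w = block_end z0" "w < z0" "w \<noteq> k" for w
    proof -
      have "cut_less (g \<circ> transpose k z0) k w z0" using lb[OF w(1) z0 _ w(3)] w(2) by simp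
      then show ?thesis using upper_z0 kz unfolding cut_less_def by blast
    qed
    have hi': "g w \<le> g z0" if w: "w \<in> {1..n}" "block_end w = block_end z0" "z0 < w" "w \<noteq> k" for w
      using hi[OF w] upper_other[of w] w by fastforce
    have lo': "g z0 \<le> g w" if w: "w \<in> {1..n}" "block_end w = block_end z0" "w < z0" "w \<noteq> k" for w
      using lo[OF w] upper_other[of w] w by fastforce
    have same: "g x \<le> g y" if "x < y" "x \<noteq> z0" "y \<noteq> z0"
      "upper (g \<circ> transpose k z0) k x = upper (g \<circ> transpose k z0) k y"
    proof -
      have "cut_less (g \<circ> transpose k z0) k x y" using lb[OF xy(1,2) _ that(1)] xy by simp
      then have "(g \<circ> transpose k z0) x \<le> (g \<circ> transpose k z0) y"
        using that(4) unfolding cut_less_def by linarith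
      then show ?thesis using swap_eq(3)[of x] swap_eq(3)[of y] False that by simp
    qed
    consider "z0 < x" "z0 < y" "x < y" | "z0 < x" "y \<le> z0" | "x = z0" "y < z0" | "x < z0" "y < z0" "x < y"
    proof -
      have "x \<noteq> k" "y \<noteq> k" using False by auto
      then show thesis using lt xy z0 that by (simp add: pos_def split: if_splits)
    qed
    then show ?thesis
    proof cases
      case 1
      then show ?thesis using same hi[of x] hi[of y] xy False by simp
    next
      case 2
      then show ?thesis using hi'[of x] lo'[of y] xy False by (cases "y = z0") simp_all
    next
      case 3
      then show ?thesis using lo'[of y] xy False by simp
    next
      case 4
      then show ?thesis using same lo[of x] lo[of y] xy False by simp
    qed
  qed
qed

text \<open>The swap puts \<open>g z0\<close> at \<open>k\<close>, so \<open>g z0\<close> is the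
  letter at which the order is cut. Outside the block of \<open>z0\<close> a tie with this letter is
  settled for the whole block by \<open>rotate_block\<close>; hence \<open>cut_less\<close> turns
  into an order on letters.\<close>

lemma sorted_other_block:
  assumes xy: "x \<in> {1..n}" "y \<in> {1..n}" "block_end x = s" "block_end y = s" "s \<noteq> block_end z0" and lt: "x < y"
  shows "letter_rank k (g z0) s (g x) \<le> letter_rank k (g z0) s (g y)"
proof -
  have xk: "x \<noteq> k"
  proof
    assume "x = k"
    then have "block_end x = x" using top_in_S block_end_in_S by simp
    then show False using block_end(2)[of y] xy lt by simp
  qed
  then have gx: "g x < q n" using not_top_less xy by simp
  have nz: "x \<noteq> z0" "y \<noteq> z0" using xy by auto
  show ?thesis
  proof (cases "y = k")
    case True
    then show ?thesis using gx k by (simp add: letter_rank_def)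
  next
    case False
    then have gy: "g y < q n" using not_top_less xy by simp
    have u: "upper (g \<circ> transpose k z0) k w \<longleftrightarrow> g w < g z0 \<or> g w = g z0 \<and> rotate s \<le> rotate k"
      if "w \<in> {x, y}" for w
      using that xy xk False nz rotate_block[OF _ _ _ top_in_S, of w] by (auto simp: upper_other)
    have "cut_less (g \<circ> transpose k z0) k x y" using less_in_block xy lt by simp
    then show ?thesis using gx gy u[of x] u[of y] nz xk False swap_eq(3)
      by (auto simp: cut_less_def letter_rank_def)
  qed
qed

end

end

lemma cut_sorted_wordsE:
  assumes "g \<in> cut_sorted_words"
  obtains k where "g \<in> words n q" "k \<in> {1..n}" "g k = q n"
    "\<And>z. z \<in> {1..n} - S \<Longrightarrow> cut_less (g \<circ> transpose k z0) k z (Suc z)"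
  using assms by (auto simp: cut_sorted_words_def)

text \<open>The word is recovered in stages: \<open>k\<close> is the end of the block containing the
  top letter; then \<open>pos k\<close> fixes the block of \<open>z0\<close> and with it the cut
  letter \<open>g z0\<close>; then \<open>letter_rank\<close> is known and fixes all other
  blocks.\<close>

lemma inj_on_cut_sorted_words: "inj_on block_msets cut_sorted_words"
proof (rule inj_onI)
  fix g h assume gh: "g \<in> cut_sorted_words" "h \<in> cut_sorted_words" and eq: "block_msets g = block_msets h"
  obtain k where k: "g \<in> words n q" "k \<in> {1..n}" "g k = q n"
    "\<And>z. z \<in> {1..n} - S \<Longrightarrow> cut_less (g \<circ> transpose k z0) k z (Suc z)"
    by (rule cut_sorted_wordsE[OF gh(1)]) blast
  obtain l where l: "h \<in> words n q" "l \<in> {1..n}" "h l = q n"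
    "\<And>z. z \<in> {1..n} - S \<Longrightarrow> cut_less (h \<circ> transpose l z0) l z (Suc z)"
    by (rule cut_sorted_wordsE[OF gh(2)]) blast
  have kS: "k \<in> S" "l \<in> S" using top_in_S k l by blast+
  obtain y where "y \<in> {1..n}" "block_end y = block_end k" "h y = q n"
    using block_msets_eqD[OF eq[symmetric] k(2)] k(3) by auto
  then have "block_end l = block_end k" using words_top[OF l(1)] l by blast
  then have "l = k" using kS block_end_in_S by metis
  note l = l[unfolded this]
  have L: "g x = h x" if x: "x \<in> {1..n}" "block_end x = block_end z0" for x
  proof (rule arrangement_unique[where X = "block (block_end z0)" and r = "pos k" and \<phi> = "\<lambda>x. x" and g = g and h = h])
    show "inj_on (pos k) (block (block_end z0))" by (rule inj_on_subset[OF inj_pos]) auto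
    show "image_mset g (mset_set (block (block_end z0))) = image_mset h (mset_set (block (block_end z0)))"
      using fun_cong[OF eq, of "block_end z0"] by (simp only: block_msets_def)
  qed (use x sorted_z0_block[OF k] sorted_z0_block[OF l] in auto)
  then have b: "g z0 = h z0" using z0 by simp
  show "g = h"
  proof
    fix x
    show "g x = h x"
    proof (cases "x \<in> {1..n} \<and> block_end x \<noteq> block_end z0")
      case True
      let ?s = "block_end x"
      have "letter_rank k (g z0) ?s (g x) = letter_rank k (g z0) ?s (h x)"
      proof (rule arrangement_unique[where X = "block ?s" and r = "\<lambda>x. x" and \<phi> = "letter_rank k (g z0) ?s" and g = g and h = h])
        show "image_mset g (mset_set (block ?s)) = image_mset h (mset_set (block ?s))"
          using fun_cong[OF eq, of ?s] by (simp only: block_msets_def)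
        fix v w assume "v \<in> block ?s" "w \<in> block ?s" "v < w"
        then show "letter_rank k (g z0) ?s (g v) \<le> letter_rank k (g z0) ?s (g w)"
          "letter_rank k (g z0) ?s (h v) \<le> letter_rank k (g z0) ?s (h w)"
          using sorted_other_block[OF k, of v w ?s] sorted_other_block[OF l, of v w ?s] True b by simp_all
      qed (use True in auto)
      then show ?thesis using letter_rank_inj words_le[OF k(1)] words_le[OF l(1)] True by blast
    next
      case False
      then show ?thesis using L k l by (cases "x \<in> {1..n}") (auto simp: words_def)
    qed
  qed
qed

section \<open>Every family of block multisets comes from a cut-sorted word\<close>

lemma rotate_before_z0:
  assumes w: "w \<in> {1..n}" "block_end w = block_end z0" "w < z0" and k: "k \<in> S" "k \<noteq> z0"
  shows "rotate k < rotate w"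
proof (cases "k < z0")
  case True
  have "k < w"
  proof (rule ccontr)
    assume "\<not> k < w"
    then have "block_end w \<le> k" using k by (intro block_end_le) auto
    then show False using True w(2) block_end(2)[OF z0] by simp
  qed
  then show ?thesis using True w z0 by (simp add: rotate_back_def)
next
  case False
  moreover have "k \<in> {1..n}" using k S_subset by auto
  ultimately show ?thesis using k w z0 by (simp add: rotate_back_def)
qed

text \<open>Together with \<open>rotate_before_z0\<close> this places letters equal to the cut
  letter, inside the block of \<open>z0\<close>, on the side of the cut required by their
  position.\<close>

lemma rotate_after_z0:
  assumes w: "w \<in> {1..n}" "block_end w = block_end z0" "z0 < w" and k: "k \<in> S"
  shows "rotate w \<le> rotate k"
proof (cases "k \<le> z0")
  case True
  moreover have "k \<in> {1..n}" using k S_subset by auto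
  ultimately show ?thesis using w z0 by (simp add: rotate_back_def)
next
  case False
  have "w \<le> k"
  proof (rule ccontr)
    assume "\<not> w \<le> k"
    moreover have "block_end z0 \<le> k" using False k by (intro block_end_le) auto
    ultimately show False using block_end(2)[OF w(1)] w(2) by simp
  qed
  then show ?thesis using False w by (simp add: rotate_back_def)
qed

lemma rotate_Suc: "z \<in> {1..n} \<Longrightarrow> Suc z \<in> {1..n} \<Longrightarrow> z \<noteq> z0 \<Longrightarrow> rotate z < rotate (Suc z)"
  using z0 by (auto simp: rotate_back_def)

text \<open>The stages of the injectivity proof are carried out as a construction: choose
  \<open>k\<close>, sort the block of \<open>z0\<close> along \<open>pos k\<close>, read off the cut
  letter, and sort the other blocks by \<open>letter_rank\<close>.\<close>

lemma cut_sorted_words_surj: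
  assumes g: "g \<in> words n q"
  shows "\<exists>h\<in>cut_sorted_words. block_msets h = block_msets g"
proof -
  obtain k0 where k0: "k0 \<in> {1..n}" "g k0 = q n" using words_top[OF g] by blast
  \<comment> \<open>Wherever the top letter stands in its block, sorting has to move it to the block
    end.\<close>
  define k where "k = block_end k0"
  have k: "k \<in> S" "k \<in> {1..n}" "block_end k = k" using block_end[OF k0(1)] block_end_in_S by (auto simp: k_def)
  obtain h1 where h1: "\<And>s. image_mset h1 (mset_set (block s)) = image_mset g (mset_set (block s))"
    "\<And>x y. x \<in> {1..n} \<Longrightarrow> y \<in> {1..n} \<Longrightarrow> block_end x = block_end y \<Longrightarrow> pos k x < pos k y \<Longrightarrow> h1 x \<le> h1 y"
    by (rule block_arrangement_exists[of "{1..n}" "pos k" block_end g "\<lambda>s x. x"]) (use inj_pos in auto)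
  \<comment> \<open>The cut letter exists only once the block of \<open>z0\<close> is arranged, so
    the other blocks need a second arrangement.\<close>
  define b where "b = h1 z0"
  obtain h2 where h2: "\<And>s. image_mset h2 (mset_set (block s)) = image_mset h1 (mset_set (block s))"
    "\<And>x y. x \<in> {1..n} \<Longrightarrow> y \<in> {1..n} \<Longrightarrow> block_end x = block_end y \<Longrightarrow> x < y \<Longrightarrow>
       letter_rank k b (block_end x) (h2 x) \<le> letter_rank k b (block_end x) (h2 y)"
    by (rule block_arrangement_exists[of "{1..n}" "\<lambda>x. x" block_end h1 "letter_rank k b"]) auto
  define h where "h x = (if x \<notin> {1..n} then 0 else if block_end x = block_end z0 then h1 x else h2 x)" for x
  have hL: "h x = h1 x" if "x \<in> {1..n}" "block_end x = block_end z0" for x using that by (simp add: h_def)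
  have hO: "h x = h2 x" if "x \<in> {1..n}" "block_end x \<noteq> block_end z0" for x using that by (simp add: h_def)
  have eq: "block_msets h = block_msets g"
  proof
    fix s
    have "image_mset h (mset_set (block s)) = image_mset (if s = block_end z0 then h1 else h2) (mset_set (block s))"
      by (rule image_mset_cong) (auto simp: h_def)
    then show "block_msets h s = block_msets g s" using h1(1) h2(1) by (simp add: block_msets_def)
  qed
  have hw: "h \<in> words n q" by (rule words_block_msets[OF g _ eq]) (simp only: h_def if_True simp_thms)
  have sL: "h x \<le> h y" if "x \<in> {1..n}" "y \<in> {1..n}" "block_end x = block_end z0" "block_end y = block_end z0"
    "pos k x < pos k y" for x y
    using h1(2)[of x y] hL that by simp
  have sO: "letter_rank k b (block_end x) (h x) \<le> letter_rank k b (block_end x) (h y)"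
    if "x \<in> {1..n}" "y \<in> {1..n}" "block_end x = block_end y" "block_end x \<noteq> block_end z0" "x < y" for x y
    using h2(2)[of x y] hO[of x] hO[of y] that by simp
  \<comment> \<open>In the block of \<open>z0\<close>, \<open>pos\<close> makes \<open>k\<close> the
    last position; in any other block \<open>letter_rank\<close> ranks the top letter
    highest.\<close>
  have hk: "h k = q n"
  proof -
    obtain y where y: "y \<in> {1..n}" "block_end y = k" "h y = q n"
      using block_msets_eqD[OF eq k0(1)] k0(2) by (auto simp: k_def)
    have le: "h k \<le> q n" using words_le[OF hw k(2)] .
    consider "y = k" | "y < k" using block_end(2)[OF y(1)] y(2) by linarith
    then show ?thesis
    proof cases
      case 2
      show ?thesis
      proof (cases "k = block_end z0")
        case True
        have "pos k y < pos k k" using 2 y(1) z0 by (simp add: pos_def)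
        then show ?thesis using sL[OF y(1) k(2)] y k True le by simp
      next
        case False
        then have "letter_rank k b k (q n) \<le> letter_rank k b k (h k)"
          using sO[OF y(1) k(2) _ _ 2] y k by simp
        then show ?thesis using le by (simp add: letter_rank_def split: if_splits)
      qed
    qed (use y in simp)
  qed
  let ?f = "h \<circ> transpose k z0"
  note not_top_less = not_top_less[OF hw k(2) hk] and swap = swap_eq[OF hw k(2) hk] and uz = upper_z0[OF hw k(2) hk]
    and uk = upper_k[OF hw k(2) hk] and uo = upper_other[OF hw k(2) hk]
  have b: "h z0 = b" using hL[OF z0] by (simp add: b_def)
  have lo: "\<not> upper ?f k w" if w: "w \<in> {1..n}" "block_end w = block_end z0" "w < z0" "k \<noteq> z0" "w \<noteq> k" for w
  proof -
    have "pos k z0 < pos k w" using w by (simp add: pos_def)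
    then have "h z0 \<le> h w" using sL z0 w by simp
    then show ?thesis using uo[of w] rotate_before_z0[OF w(1-3) k(1)] w by simp
  qed
  have hi: "upper ?f k w" if w: "w \<in> {1..n}" "block_end w = block_end z0" "z0 < w" "k \<noteq> z0" "w \<noteq> k" for w
  proof -
    have "pos k w < pos k z0" using w by (simp add: pos_def)
    then have "h w \<le> h z0" using sL z0 w by simp
    then show ?thesis using uo[of w] rotate_after_z0[OF w(1-3) k(1)] w by auto
  qed
  have "cut_less ?f k z (Suc z)" if z: "z \<in> {1..n} - S" for z
  proof -
    have sz: "z < n" "Suc z \<in> {1..n}" "block_end (Suc z) = block_end z" using block_end_Suc[OF z] by auto
    have zk: "z \<noteq> k" using z k by auto
    have z': "z \<in> {1..n}" using z by simp
    have hz: "h z < q n" using not_top_less zk z by simp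
    \<comment> \<open>Away from \<open>z0\<close> the rotated position increases with
      \<open>z\<close>, so equal letters on the same side of the cut are in order.\<close>
    have same: "cut_less ?f k z (Suc z)"
      if "upper ?f k z = upper ?f k (Suc z)" "?f z \<le> ?f (Suc z)" "z \<noteq> z0"
      using that rotate_Suc[OF z' sz(2)] unfolding cut_less_def by linarith
    show ?thesis
    proof (cases "block_end z = block_end z0")
      case L: True
      have mono: "h z \<le> h (Suc z)" if "z \<noteq> z0" "Suc z \<noteq> z0" "Suc z \<noteq> k"
      proof -
        have "pos k z < pos k (Suc z)" using that zk by (simp add: pos_def)
        then show ?thesis using sL z' sz L by simp
      qed
      show ?thesis
      proof (cases "k = z0")
        case True
        have "Suc z \<le> z0" using block_end(2)[OF sz(2)] sz(3) L k True by simp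
        have hz0: "h z0 = q n" using hk True by simp
        have up: "upper ?f k w" if "w \<in> {1..n}" "w \<noteq> k" for w
          using not_top_less[OF that] uo[of w] that hz0 True by metis
        have "upper ?f k z" using up[OF z' zk] .
        moreover have "upper ?f k (Suc z)" using up[OF sz(2)] uk by metis
        moreover have "?f z \<le> ?f (Suc z)"
        proof (cases "Suc z = k")
          case True
          then show ?thesis using swap(2) swap(3)[of z] hz hz0 zk \<open>Suc z \<le> z0\<close> by simp
        next
          case False
          then show ?thesis using mono swap(3)[of z] swap(3)[of "Suc z"] zk \<open>k = z0\<close> by simp
        qed
        moreover have "z \<noteq> z0" using zk True by simp
        ultimately show ?thesis using same by blast
      next
        case False
        consider "Suc z < z0" | "Suc z = z0" | "z = z0" | "z0 < z" by linarith
        then show ?thesis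
        proof cases
          case 1
          have "Suc z \<noteq> k" using 1 k L sz block_end(2)[OF z0] by auto
          moreover from this have "?f z \<le> ?f (Suc z)"
            using mono swap(3)[of z] swap(3)[of "Suc z"] 1 zk by simp
          moreover have "\<not> upper ?f k z" "\<not> upper ?f k (Suc z)"
            using lo[OF z' L _ False zk] lo[OF sz(2) _ 1 False] 1 sz(3) L calculation(1) by (linarith, metis)
          moreover have "z \<noteq> z0" using 1 by simp
          ultimately show ?thesis using same by blast
        next
          case 2
          have zz: "z < z0" "z \<noteq> z0" using 2 by linarith+
          have "?f (Suc z) = q n" unfolding 2 by (rule swap(1))
          then have "?f z \<le> ?f (Suc z)" using swap(3)[OF zk zz(2)] hz by linarith
          moreover have "\<not> upper ?f k z" by (rule lo[OF z' L zz(1) False zk])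
          moreover have "\<not> upper ?f k (Suc z)" unfolding 2 using uz False by blast
          moreover note zz(2)
          ultimately show ?thesis using same by blast
        next
          case 3
          then have "z0 < Suc z" by simp
          then have "upper ?f k (Suc z)" using hi[OF sz(2)] uk sz(3) L False by metis
          then show ?thesis using 3 uz False unfolding cut_less_def by blast
        next
          case 4
          then have "z0 < Suc z" by simp
          then have "upper ?f k (Suc z)" using hi[OF sz(2)] uk sz(3) L False by metis
          moreover have u: "upper ?f k z" using hi[of z] 4 z' L False zk by simp
          moreover have "?f z \<le> ?f (Suc z)"
          proof (cases "Suc z = k")
            case True
            have "h z \<le> h z0" using u uo[of z] zk 4 by linarith
            then show ?thesis using swap(2) swap(3)[of z] zk 4 True by simp
          next
            case False
            then show ?thesis using mono swap(3)[of z] swap(3)[of "Suc z"] zk 4 by simp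
          qed
          moreover have "z \<noteq> z0" using 4 by simp
          ultimately show ?thesis using same by blast
        qed
      qed
    next
      case O: False
      let ?s = "block_end z"
      have nz: "z \<noteq> z0" "Suc z \<noteq> z0" using O sz by auto
      have u: "upper ?f k w \<longleftrightarrow> h w < b \<or> h w = b \<and> rotate ?s \<le> rotate k"
        if "w \<in> {z, Suc z}" "w \<noteq> k" for w
      proof -
        have "w \<in> {1..n}" "block_end w = ?s" "w \<noteq> z0" using that(1) z' sz nz by auto
        then show ?thesis using uo[of w] rotate_block[of w k, OF _ that(2) _ k(1)] that(2) b O by simp
      qed
      show ?thesis
      proof (cases "Suc z = k")
        case True
        have "?f z \<le> ?f (Suc z)" if "upper ?f k z"
        proof -
          have "h z \<le> h z0" using that uo[of z] zk nz by linarith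
          then show ?thesis using swap(2) swap(3)[of z] zk nz True by simp
        qed
        moreover have "upper ?f k (Suc z)" using uk True by simp
        ultimately show ?thesis using same nz unfolding cut_less_def by blast
      next
        case False
        have "letter_rank k b ?s (h z) \<le> letter_rank k b ?s (h (Suc z))" using sO[OF z' sz(2)] sz O by simp
        moreover have "h (Suc z) < q n" using not_top_less sz False by simp
        ultimately have "\<not> upper ?f k z \<and> upper ?f k (Suc z) \<or>
          upper ?f k z = upper ?f k (Suc z) \<and> h z \<le> h (Suc z)"
          using u[of z] u[of "Suc z"] zk False hz unfolding letter_rank_def
          by (simp split: if_splits) linarith+
        moreover have "?f z = h z" "?f (Suc z) = h (Suc z)"
          using swap(3)[of z] swap(3)[of "Suc z"] zk False nz by simp_all
        ultimately show ?thesis using same nz unfolding cut_less_def by metis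
      qed
    qed
  qed
  then have "h \<in> cut_sorted_words" using hw k hk by (auto simp: cut_sorted_words_def)
  then show ?thesis using eq by blast
qed

text \<open>Both sets contain exactly one representative for each family of block multisets arising
  from a word.\<close>

lemma card_cut_sorted_words: "card cut_sorted_words = card sorted_words"
proof -
  have im: "block_msets ` A = block_msets ` words n q"
    if "A \<subseteq> words n q" "\<And>g. g \<in> words n q \<Longrightarrow> \<exists>h\<in>A. block_msets h = block_msets g" for A
  proof
    show "block_msets ` words n q \<subseteq> block_msets ` A" using that(2) by (metis image_eqI image_subsetI)
  qed (use that(1) in blast)
  have "block_msets ` cut_sorted_words = block_msets ` words n q"
    by (rule im[OF _ cut_sorted_words_surj]) (auto simp: cut_sorted_words_def)
  moreover have "block_msets ` sorted_words = block_msets ` words n q"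
    by (rule im[OF _ sorted_words_surj]) (auto simp: sorted_words_def)
  ultimately show ?thesis
    using card_image[OF inj_on_sorted_words] card_image[OF inj_on_cut_sorted_words] by simp
qed

end

section \<open>Vertical rotations as words\<close>

lemma cyc_funpow:
  assumes "i \<in> {1..n}" "j \<le> n"
  shows "(cyc n ^^ j) i = (if i + j \<le> n then i + j else i + j - n)"
  using assms(2)
proof (induction j)
  case (Suc j)
  then show ?case using assms(1) by (auto simp: cyc_def)
qed (use assms in simp)

lemma cyc_permutes:
  assumes "n \<ge> 1" shows "cyc n permutes {1..n}"
proof (rule bij_imp_permutes)
  have inj: "inj_on (cyc n) {1..n}" by (rule inj_onI) (auto simp: cyc_def split: if_splits)
  have "cyc n ` {1..n} \<subseteq> {1..n}" using assms by (auto simp: cyc_def)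
  then show "bij_betw (cyc n) {1..n} {1..n}" using inj by (simp add: bij_betw_def endo_inj_surj)
qed (use assms in \<open>auto simp: cyc_def\<close>)

text \<open>This is the orbit under vertical rotation of the members of \<open>block_perms\<close>
  that fix \<open>n\<close>.\<close>

definition rot_perms :: "nat \<Rightarrow> (nat \<Rightarrow> nat) \<Rightarrow> (nat \<Rightarrow> nat) set" where
  "rot_perms n q = {(cyc n ^^ j) \<circ> \<sigma> | j \<sigma>. j < n \<and> \<sigma> \<in> block_perms n q \<and> \<sigma> n = n}"

context cut_words
begin

lemma cyc_funpow_permutes: "(cyc n ^^ j) permutes {1..n}"
  by (rule permutes_funpow[OF cyc_permutes]) (use z0 in simp)

definition rot :: "nat \<Rightarrow> nat" where "rot z = (if z \<in> {1..n} then rotate z else z)"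

lemma rot_permutes: "rot permutes {1..n}"
proof (rule bij_imp_permutes)
  have inj: "inj_on rot {1..n}"
  proof (rule inj_onI)
    fix x y assume "x \<in> {1..n}" "y \<in> {1..n}" "rot x = rot y"
    then show "x = y" using z0 by (simp add: rot_def rotate_back_def split: if_splits) 
  qed
  have "rot ` {1..n} \<subseteq> {1..n}" using z0 by (auto simp: rot_def rotate_back_def)
  then show "bij_betw rot {1..n} {1..n}" using inj by (simp add: bij_betw_def endo_inj_surj)
qed (auto simp: rot_def)

lemma rot_z0: "rot z0 = n"
  using z0 by (simp add: rot_def rotate_back_def)

lemma rot_in: "z \<in> {1..n} \<Longrightarrow> rot z \<in> {1..n}"
  using permutes_in_image[OF rot_permutes] by blast

section \<open>Rotated permutations encoded by the position of their maximum\<close>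

definition pairs :: "((nat \<Rightarrow> nat) \<times> nat) set" where
  "pairs = {(\<sigma>, k). \<sigma> \<in> block_perms n q \<and> \<sigma> n = n \<and> k \<in> {1..n}}"

text \<open>The exponent is the one that moves the value at position \<open>rot k\<close> to
  \<open>n\<close>; thus \<open>k\<close> replaces the exponent as parameter.\<close>

definition pair_perm :: "(nat \<Rightarrow> nat) \<times> nat \<Rightarrow> nat \<Rightarrow> nat" where
  "pair_perm = (\<lambda>(\<sigma>, k). (cyc n ^^ (n - \<sigma> (rot k))) \<circ> \<sigma>)"

text \<open>The largest value of \<open>\<sigma> \<circ> rot\<close> is at \<open>z0\<close>. Moving
  its letter to \<open>k\<close> makes the word remember \<open>k\<close> as well as
  \<open>\<sigma>\<close>.\<close>

definition pair_word :: "(nat \<Rightarrow> nat) \<times> nat \<Rightarrow> nat \<Rightarrow> nat" where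
  "pair_word = (\<lambda>(\<sigma>, k). word_of n q (\<sigma> \<circ> rot \<circ> transpose k z0))"

lemma block_perms_permutes: "\<sigma> \<in> block_perms n q \<Longrightarrow> \<sigma> permutes {1..n}"
  by (simp add: block_perms_def)

lemma transpose_permutes: "k \<in> {1..n} \<Longrightarrow> transpose k z0 permutes {1..n}"
  by (rule permutes_swap_id[OF _ z0])

lemma pair_perm_apply:
  assumes "(\<sigma>, k) \<in> pairs" "x \<in> {1..n}"
  shows "pair_perm (\<sigma>, k) x = (if \<sigma> x \<le> \<sigma> (rot k) then \<sigma> x + n - \<sigma> (rot k) else \<sigma> x - \<sigma> (rot k))"
proof -
  have p: "\<sigma> permutes {1..n}" and k: "k \<in> {1..n}" using assms by (auto simp: pairs_def block_perms_def)
  have "\<sigma> x \<in> {1..n}" "\<sigma> (rot k) \<in> {1..n}"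
    using permutes_in_image[OF p] assms(2) rot_in[OF k] by blast+
  then show ?thesis by (auto simp: pair_perm_def cyc_funpow)
qed

lemma pair_perm_permutes: "(\<sigma>, k) \<in> pairs \<Longrightarrow> pair_perm (\<sigma>, k) permutes {1..n}"
  unfolding pair_perm_def pairs_def using cyc_funpow_permutes block_perms_permutes
  by (auto intro!: permutes_compose)

text \<open>The value \<open>n\<close> stands at position \<open>rot k\<close>, which gives
  \<open>k\<close>; as \<open>\<sigma>\<close> fixes \<open>n\<close>, the value at position
  \<open>n\<close> then gives the exponent.\<close>

lemma pair_perm_bij: "bij_betw pair_perm pairs (rot_perms n q)"
proof (rule bij_betwI')
  fix a b assume ab: "a \<in> pairs" "b \<in> pairs"
  obtain \<sigma> k \<tau> l where e: "a = (\<sigma>, k)" "b = (\<tau>, l)" by fastforce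
  have s: "\<sigma> permutes {1..n}" "\<tau> permutes {1..n}" "k \<in> {1..n}" "l \<in> {1..n}" "\<sigma> n = n" "\<tau> n = n"
    using ab e by (auto simp: pairs_def block_perms_def)
  have n: "n \<in> {1..n}" using z0 by simp
  have t: "\<sigma> (rot k) \<in> {1..n}" "\<tau> (rot l) \<in> {1..n}"
    using permutes_in_image[OF s(1)] permutes_in_image[OF s(2)] rot_in s by blast+
  show "pair_perm a = pair_perm b \<longleftrightarrow> a = b"
  proof
    assume eq: "pair_perm a = pair_perm b"
    have "pair_perm a (rot k) = n" "pair_perm a (rot l) = n"
      using pair_perm_apply[of \<sigma> k "rot k"] pair_perm_apply[of \<tau> l "rot l"] ab e rot_in s t eq by simp_all
    then have "rot k = rot l" using permutes_inj[OF pair_perm_permutes[of \<sigma> k]] ab e by (metis injD)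
    then have kl: "k = l" using permutes_inj[OF rot_permutes] by (metis injD)
    have "pair_perm a n = pair_perm b n" using eq by simp
    then have tt: "\<sigma> (rot k) = \<tau> (rot l)"
      using pair_perm_apply[of \<sigma> k n] pair_perm_apply[of \<tau> l n] ab e s t n by (auto split: if_splits)
    have "(cyc n ^^ (n - \<sigma> (rot k))) (\<sigma> x) = (cyc n ^^ (n - \<sigma> (rot k))) (\<tau> x)" for x
      using fun_cong[OF eq, of x] e tt by (simp add: pair_perm_def)
    then have "\<sigma> = \<tau>" using permutes_inj[OF cyc_funpow_permutes] by (metis injD ext)
    then show "a = b" using e kl by simp
  qed simp
next
  fix a assume "a \<in> pairs"
  then obtain \<sigma> k where a: "a = (\<sigma>, k)" "\<sigma> \<in> block_perms n q" "\<sigma> n = n" "k \<in> {1..n}" by (auto simp: pairs_def)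
  have "\<sigma> (rot k) \<in> {1..n}" using permutes_in_image[OF block_perms_permutes[OF a(2)]] rot_in[OF a(4)] by blast
  then have "n - \<sigma> (rot k) < n" by auto
  then show "pair_perm a \<in> rot_perms n q" using a unfolding rot_perms_def pair_perm_def by auto
next
  fix \<pi> assume "\<pi> \<in> rot_perms n q"
  then obtain j \<sigma> where p: "\<pi> = (cyc n ^^ j) \<circ> \<sigma>" "j < n" "\<sigma> \<in> block_perms n q" "\<sigma> n = n" by (auto simp: rot_perms_def)
  have sp: "\<sigma> permutes {1..n}" by (rule block_perms_permutes[OF p(3)])
  define k where "k = inv rot (inv \<sigma> (n - j))"
  have "n - j \<in> {1..n}" using p by auto
  then have "k \<in> {1..n}"
    using permutes_in_image[OF permutes_inv[OF sp]] permutes_in_image[OF permutes_inv[OF rot_permutes]]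
    by (simp only: k_def)
  moreover have "\<sigma> (rot k) = n - j" using permutes_inverses[OF sp] permutes_inverses[OF rot_permutes] by (simp add: k_def)
  ultimately have "(\<sigma>, k) \<in> pairs" "\<pi> = pair_perm (\<sigma>, k)" using p by (auto simp: pairs_def pair_perm_def)
  then show "\<exists>a\<in>pairs. \<pi> = pair_perm a" by blast
qed

context
  assumes q_mono: "mono_on {1..n} q"
begin

lemma pair_word_swap:
  assumes "(\<sigma>, k) \<in> pairs" "z \<in> {1..n}"
  shows "(pair_word (\<sigma>, k) \<circ> transpose k z0) z = q (\<sigma> (rot z))"
proof -
  have "transpose k z0 z \<in> {1..n}"
    using permutes_in_image[OF transpose_permutes] assms by (auto simp: pairs_def)
  then show ?thesis by (simp add: pair_word_def word_of_def)
qed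

lemma pair_word_top: "(\<sigma>, k) \<in> pairs \<Longrightarrow> pair_word (\<sigma>, k) k = q n"
  using rot_z0 by (auto simp: pairs_def pair_word_def word_of_def)

lemma pair_word_words: "(\<sigma>, k) \<in> pairs \<Longrightarrow> pair_word (\<sigma>, k) \<in> words n q"
  unfolding pair_word_def pairs_def
  by (auto intro!: word_of_in_words permutes_compose[OF _ block_perms_permutes] permutes_compose[OF transpose_permutes rot_permutes]
      simp: comp_assoc)

text \<open>The unique top letter of a word gives \<open>k\<close>. Undoing the swap and the
  rotation leaves a word with its top letter at \<open>n\<close>, whose standardization therefore
  fixes \<open>n\<close>.\<close>

lemma pair_word_bij: "bij_betw pair_word pairs (words n q)"
proof (rule bij_betwI')
  fix a b assume ab: "a \<in> pairs" "b \<in> pairs"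
  obtain \<sigma> k \<tau> l where e: "a = (\<sigma>, k)" "b = (\<tau>, l)" by fastforce
  show "pair_word a = pair_word b \<longleftrightarrow> a = b"
  proof
    assume eq: "pair_word a = pair_word b"
    have "k \<in> {1..n}" "l \<in> {1..n}" using ab e by (auto simp: pairs_def)
    moreover have "pair_word a k = q n" "pair_word a l = q n"
      using pair_word_top[of \<sigma> k] pair_word_top[of \<tau> l] ab e eq by simp_all
    moreover have "pair_word a \<in> words n q" using pair_word_words ab e by simp
    ultimately have kl: "k = l" using words_top by blast
    have qq: "q (\<sigma> (rot z)) = q (\<tau> (rot z))" if "z \<in> {1..n}" for z
      using pair_word_swap[of \<sigma> k z] pair_word_swap[of \<tau> l z] ab e eq kl that by simp
    have "word_of n q \<sigma> = word_of n q \<tau>"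
    proof
      fix x
      show "word_of n q \<sigma> x = word_of n q \<tau> x"
        using qq[of "inv rot x"] permutes_in_image[OF permutes_inv[OF rot_permutes], of x]
          permutes_inverses[OF rot_permutes] by (simp add: word_of_def)
    qed
    then have "\<sigma> = \<tau>" using bij_betw_imp_inj_on[OF block_perms_words_bij[OF q_mono]] ab e
      by (auto simp: pairs_def dest: inj_onD)
    then show "a = b" using e kl by simp
  qed simp
next
  fix a assume "a \<in> pairs"
  then show "pair_word a \<in> words n q" using pair_word_words by (cases a) simp
next
  fix g assume g: "g \<in> words n q"
  obtain k where k: "k \<in> {1..n}" "g k = q n" using words_top[OF g] by blast
  define f where "f = g \<circ> (transpose k z0 \<circ> inv rot)"
  have "f \<in> words n q" unfolding f_def
    by (intro words_comp_permutes[OF g] permutes_compose[OF permutes_inv[OF rot_permutes] transpose_permutes[OF k(1)]])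
  then obtain \<sigma> where s: "\<sigma> \<in> block_perms n q" "f = word_of n q \<sigma>"
    using block_perms_words_bij[OF q_mono] by (auto simp: bij_betw_def)
  have n: "n \<in> {1..n}" using z0 by simp
  have "inv rot n = z0" using permutes_inverses(2)[OF rot_permutes, of z0] rot_z0 by simp
  then have "f n = q n" using k by (simp add: f_def)
  then have "q (\<sigma> n) = q n" using s n by (simp add: word_of_def)
  moreover have "\<sigma> n \<in> {1..n}" using permutes_in_image[OF block_perms_permutes[OF s(1)]] n by blast
  ultimately have "\<sigma> n = n" using q_less[of "\<sigma> n"] by (cases "\<sigma> n = n") auto
  then have pr: "(\<sigma>, k) \<in> pairs" using s k by (simp add: pairs_def)
  have "g x = pair_word (\<sigma>, k) x" for x
  proof (cases "x \<in> {1..n}")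
    case True
    define y where "y = transpose k z0 x"
    have y: "y \<in> {1..n}" using permutes_in_image[OF transpose_permutes[OF k(1)]] True by (simp only: y_def)
    have x: "x = transpose k z0 y" by (simp add: y_def)
    have "g x = f (rot y)" using permutes_inverses(2)[OF rot_permutes] by (simp add: f_def x)
    also have "\<dots> = q (\<sigma> (rot y))" using s rot_in[OF y] by (simp add: word_of_def)
    also have "\<dots> = pair_word (\<sigma>, k) x" using pair_word_swap[OF pr y] x by simp
    finally show ?thesis .
  next
    case False
    then show ?thesis using g pair_word_words[OF pr] by (auto simp: words_def)
  qed
  then show "\<exists>a\<in>pairs. g = pair_word a" using pr by blast
qed

text \<open>The vertical rotation lifts exactly the values up to \<open>\<sigma> (rot k)\<close>
  above the others and keeps the order within both parts; \<open>cut_less\<close> expresses this in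
  letters.\<close>

lemma pair_perm_less_iff:
  assumes p: "(\<sigma>, k) \<in> pairs" and zy: "z \<in> {1..n}" "y \<in> {1..n}"
  shows "pair_perm (\<sigma>, k) (rot z) < pair_perm (\<sigma>, k) (rot y) \<longleftrightarrow>
    cut_less (pair_word (\<sigma>, k) \<circ> transpose k z0) k z y"
proof -
  have k: "k \<in> {1..n}" and s: "\<sigma> \<in> block_perms n q" using p by (auto simp: pairs_def)
  have less: "\<sigma> (rot a) < \<sigma> (rot b) \<longleftrightarrow> q (\<sigma> (rot a)) < q (\<sigma> (rot b)) \<or>
    q (\<sigma> (rot a)) = q (\<sigma> (rot b)) \<and> rotate a < rotate b" if "a \<in> {1..n}" "b \<in> {1..n}" for a b
    using block_perms_less_iff[OF q_mono s rot_in[OF that(1)] rot_in[OF that(2)]] that by (simp add: rot_def)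
  have up: "upper (pair_word (\<sigma>, k) \<circ> transpose k z0) k a \<longleftrightarrow> \<sigma> (rot a) \<le> \<sigma> (rot k)" if "a \<in> {1..n}" for a
    using less[OF k that] unfolding upper_def pair_word_swap[OF p k] pair_word_swap[OF p that] by linarith
  have inr: "\<sigma> (rot a) \<in> {1..n}" if "a \<in> {1..n}" for a
    using permutes_in_image[OF block_perms_permutes[OF s]] rot_in[OF that] by blast
  have "cut_less (pair_word (\<sigma>, k) \<circ> transpose k z0) k z y \<longleftrightarrow>
    \<not> \<sigma> (rot z) \<le> \<sigma> (rot k) \<and> \<sigma> (rot y) \<le> \<sigma> (rot k) \<or>
    (\<sigma> (rot z) \<le> \<sigma> (rot k) \<longleftrightarrow> \<sigma> (rot y) \<le> \<sigma> (rot k)) \<and> \<sigma> (rot z) < \<sigma> (rot y)"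
    unfolding cut_less_def up[OF zy(1)] up[OF zy(2)] pair_word_swap[OF p zy(1)] pair_word_swap[OF p zy(2)]
    using less[OF zy] by blast
  moreover have "pair_perm (\<sigma>, k) (rot z) < pair_perm (\<sigma>, k) (rot y) \<longleftrightarrow>
    \<not> \<sigma> (rot z) \<le> \<sigma> (rot k) \<and> \<sigma> (rot y) \<le> \<sigma> (rot k) \<or>
    (\<sigma> (rot z) \<le> \<sigma> (rot k) \<longleftrightarrow> \<sigma> (rot y) \<le> \<sigma> (rot k)) \<and> \<sigma> (rot z) < \<sigma> (rot y)"
    using pair_perm_apply[OF p rot_in[OF zy(1)]] pair_perm_apply[OF p rot_in[OF zy(2)]]
      inr[OF zy(1)] inr[OF zy(2)] inr[OF k] by auto
  ultimately show ?thesis by blast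
qed

text \<open>Pairs carry the left side to \<open>cut_sorted_words\<close>, standardization carries
  the right side to \<open>sorted_words\<close>, and these have equally many elements. The right
  side does not involve \<open>z0\<close>.\<close>

lemma card_rot_perms:
  "card {\<pi> \<in> rot_perms n q. \<forall>z\<in>{1..n}-S. \<pi> (rot z) < \<pi> (rot (Suc z))} =
   card {\<rho> \<in> block_perms n q. \<forall>z\<in>{1..n}-S. \<rho> z < \<rho> (Suc z)}"
proof -
  define C where "C = {a \<in> pairs. \<forall>z\<in>{1..n}-S. pair_perm a (rot z) < pair_perm a (rot (Suc z))}"
  have CA: "pair_perm ` C = {\<pi> \<in> rot_perms n q. \<forall>z\<in>{1..n}-S. \<pi> (rot z) < \<pi> (rot (Suc z))}"
    using bij_betw_imp_surj_on[OF pair_perm_bij] by (auto simp: C_def)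
  have Ci: "a \<in> C \<longleftrightarrow> pair_word a \<in> cut_sorted_words" if a: "a \<in> pairs" for a
  proof -
    obtain \<sigma> k where ak: "a = (\<sigma>, k)" by fastforce
    have p: "(\<sigma>, k) \<in> pairs" using a ak by simp
    have k: "k \<in> {1..n}" using p by (simp add: pairs_def)
    note w = pair_word_words[OF p] and t = pair_word_top[OF p]
    have "a \<in> C \<longleftrightarrow> (\<forall>z\<in>{1..n}-S. cut_less (pair_word a \<circ> transpose k z0) k z (Suc z))"
      using pair_perm_less_iff[OF p] block_end_Suc p by (simp add: C_def ak)
    \<comment> \<open>The existential witness in \<open>cut_sorted_words\<close> must be this
      \<open>k\<close>, because the top letter occurs only once.\<close>
    also have "\<dots> \<longleftrightarrow> pair_word a \<in> cut_sorted_words"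
      unfolding cut_sorted_words_def ak using w t k words_top[OF w] by blast
    finally show ?thesis .
  qed
  have CB: "pair_word ` C = cut_sorted_words"
  proof
    show "pair_word ` C \<subseteq> cut_sorted_words" using Ci by (auto simp: C_def)
    show "cut_sorted_words \<subseteq> pair_word ` C"
    proof
      fix g assume g: "g \<in> cut_sorted_words"
      then have "g \<in> pair_word ` pairs"
        using bij_betw_imp_surj_on[OF pair_word_bij] by (simp add: cut_sorted_words_def)
      then show "g \<in> pair_word ` C" using Ci g by blast
    qed
  qed
  have sub: "C \<subseteq> pairs" by (auto simp: C_def)
  have "card (pair_perm ` C) = card (pair_word ` C)"
    using card_image[OF inj_on_subset[OF bij_betw_imp_inj_on[OF pair_perm_bij] sub]]
      card_image[OF inj_on_subset[OF bij_betw_imp_inj_on[OF pair_word_bij] sub]] by simp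
  also have "\<dots> = card sorted_words" using CB card_cut_sorted_words by simp
  also have "sorted_words = word_of n q ` {\<rho> \<in> block_perms n q. \<forall>z\<in>{1..n}-S. \<rho> z < \<rho> (Suc z)}"
  proof -
    have iff: "(\<forall>z\<in>{1..n}-S. \<rho> z < \<rho> (Suc z)) \<longleftrightarrow> (\<forall>z\<in>{1..n}-S. word_of n q \<rho> z \<le> word_of n q \<rho> (Suc z))"
      if "\<rho> \<in> block_perms n q" for \<rho>
    proof (rule ball_cong[OF refl])
      fix z assume z: "z \<in> {1..n} - S"
      then show "\<rho> z < \<rho> (Suc z) \<longleftrightarrow> word_of n q \<rho> z \<le> word_of n q \<rho> (Suc z)"
        using block_perms_less_iff[OF q_mono that, of z "Suc z"] block_end_Suc[OF z]
        by (auto simp: word_of_def)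
    qed
    have "sorted_words = word_of n q ` {\<rho> \<in> block_perms n q. \<forall>z\<in>{1..n}-S. word_of n q \<rho> z \<le> word_of n q \<rho> (Suc z)}"
      unfolding sorted_words_def bij_betw_imp_surj_on[OF block_perms_words_bij[OF q_mono], symmetric] by blast
    also have "{\<rho> \<in> block_perms n q. \<forall>z\<in>{1..n}-S. word_of n q \<rho> z \<le> word_of n q \<rho> (Suc z)} =
      {\<rho> \<in> block_perms n q. \<forall>z\<in>{1..n}-S. \<rho> z < \<rho> (Suc z)}"
      using iff by (intro Collect_cong) metis
    finally show ?thesis .
  qed
  also have "card (word_of n q ` {\<rho> \<in> block_perms n q. \<forall>z\<in>{1..n}-S. \<rho> z < \<rho> (Suc z)}) =
    card {\<rho> \<in> block_perms n q. \<forall>z\<in>{1..n}-S. \<rho> z < \<rho> (Suc z)}"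
    by (rule card_image, rule inj_on_subset[OF bij_betw_imp_inj_on[OF block_perms_words_bij[OF q_mono]]]) auto
  finally show ?thesis using CA by simp
qed

end

end

section \<open>Equidistribution of descents\<close>

text \<open>Inclusion-exclusion in inductive form: the terms for proper subsets already agree and
  cancel from the sums.\<close>

lemma subset_sums_determine:
  fixes f g :: "'a set \<Rightarrow> nat"
  assumes fin: "finite U" and eq: "\<And>A. A \<subseteq> U \<Longrightarrow> sum f (Pow A) = sum g (Pow A)" and A: "A \<subseteq> U"
  shows "f A = g A"
proof -
  have "finite A" using A fin by (rule finite_subset)
  then show ?thesis using A
  proof (induction A rule: finite_psubset_induct)
    case (psubset A)
    have "sum h (Pow A) = h A + sum h (Pow A - {A})" for h :: "'a set \<Rightarrow> nat"
      using psubset(1) by (simp add: sum.remove)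
    moreover have "sum f (Pow A - {A}) = sum g (Pow A - {A})"
      using psubset by (intro sum.cong) auto
    ultimately show ?case using eq[OF psubset.prems] by simp
  qed
qed

lemma card_subset_eq_sum:
  assumes "finite A" "finite T"
  shows "card {a\<in>A. d a \<subseteq> T} = (\<Sum>K\<in>Pow T. card {a\<in>A. d a = K})"
proof -
  have "{a\<in>A. d a \<subseteq> T} = (\<Union>K\<in>Pow T. {a\<in>A. d a = K})" by auto
  also have "card \<dots> = (\<Sum>K\<in>Pow T. card {a\<in>A. d a = K})"
    using assms by (intro card_UN_disjoint) auto
  finally show ?thesis .
qed

text \<open>The counts for containment determine those for equality, so corresponding fibres have
  equal size and can be matched one by one.\<close>

lemma equidistributed_bij:
  assumes fin: "finite A" "finite B" "finite U"
    and sub: "\<And>a. a \<in> A \<Longrightarrow> d a \<subseteq> U" "\<And>b. b \<in> B \<Longrightarrow> d' b \<subseteq> U"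
    and eq: "\<And>T. T \<subseteq> U \<Longrightarrow> card {a\<in>A. d a \<subseteq> T} = card {b\<in>B. d' b \<subseteq> T}"
  obtains \<phi> where "bij_betw \<phi> A B" "\<And>a. a \<in> A \<Longrightarrow> d' (\<phi> a) = d a"
proof -
  have "card {a\<in>A. d a = T} = card {b\<in>B. d' b = T}" for T
  proof (cases "T \<subseteq> U")
    case True
    show ?thesis
    proof (rule subset_sums_determine[OF fin(3) _ True])
      fix S assume S: "S \<subseteq> U"
      then have "finite S" using fin(3) by (rule finite_subset)
      then show "(\<Sum>K\<in>Pow S. card {a\<in>A. d a = K}) = (\<Sum>K\<in>Pow S. card {b\<in>B. d' b = K})"
        using card_subset_eq_sum[of A S d] card_subset_eq_sum[of B S d'] eq[OF S] fin by simp
    qed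
  next
    case False
    then have "{a\<in>A. d a = T} = {}" "{b\<in>B. d' b = T} = {}" using sub by auto
    then show ?thesis by (simp only: card.empty)
  qed
  moreover have "finite {a\<in>A. d a = T}" "finite {b\<in>B. d' b = T}" for T using fin by simp_all
  ultimately have "\<forall>T. \<exists>h. bij_betw h {a\<in>A. d a = T} {b\<in>B. d' b = T}"
    using bij_betw_iff_card by blast
  from choice[OF this] obtain h where h: "\<And>T. bij_betw (h T) {a\<in>A. d a = T} {b\<in>B. d' b = T}" by blast
  define \<phi> where "\<phi> a = h (d a) a" for a
  have \<phi>: "\<phi> a \<in> B \<and> d' (\<phi> a) = d a" if "a \<in> A" for a
    using bij_betwE[OF h[of "d a"]] that by (simp add: \<phi>_def)
  have "bij_betw \<phi> A B"
  proof (rule bij_betwI')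
    fix x y assume xy: "x \<in> A" "y \<in> A"
    show "\<phi> x = \<phi> y \<longleftrightarrow> x = y"
    proof
      assume e: "\<phi> x = \<phi> y"
      then have "d x = d y" using \<phi> xy by metis
      then show "x = y" using e xy inj_onD[OF bij_betw_imp_inj_on[OF h[of "d x"]], of x y] by (simp add: \<phi>_def)
    qed simp
  next
    fix b assume b: "b \<in> B"
    then have "b \<in> h (d' b) ` {a\<in>A. d a = d' b}" using bij_betw_imp_surj_on[OF h[of "d' b"]] by simp
    then obtain a where "a \<in> A" "d a = d' b" "b = h (d' b) a" by blast
    then have "a \<in> A" "b = \<phi> a" by (simp_all only: \<phi>_def)
    then show "\<exists>a\<in>A. b = \<phi> a" by blast
  qed (use \<phi> in blast)
  then show ?thesis using that \<phi> by blast
qed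

text \<open>For \<open>r\<close> and \<open>C\<close> inside \<open>{1..n}\<close> this is the
  cyclic translate \<open>r + C\<close>, written as a preimage.\<close>

definition rotate_set :: "nat \<Rightarrow> nat \<Rightarrow> nat set \<Rightarrow> nat set" where
  "rotate_set n r C = {z\<in>{1..n}. rotate_back n r z \<in> C}"

text \<open>On values below \<open>n\<close> the label increases just after each element of
  \<open>J\<close>. The label \<open>n\<close> exceeds all those counts, so the value
  \<open>n\<close> forms a run by itself.\<close>

definition blocks :: "nat \<Rightarrow> nat set \<Rightarrow> nat \<Rightarrow> nat" where
  "blocks n J i = (if i < n then card {j\<in>J. j < i} else n)"

text \<open>Since \<open>Des (n - 1)\<close> inspects only places up to \<open>n - 2\<close>, the
  values \<open>n - 1\<close> and \<open>n\<close> are not compared; this is the freedom of the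
  detached box.\<close>

definition box_perms :: "nat \<Rightarrow> nat set \<Rightarrow> (nat \<Rightarrow> nat) set" where
  "box_perms n J = {\<rho>. \<rho> permutes {1..n} \<and> Des (n - 1) (inv \<rho>) = J}"

abbreviation (input) rotated_class :: "nat \<Rightarrow> nat set \<Rightarrow> (nat \<Rightarrow> nat) set" where
  "rotated_class n J \<equiv> rotClass n (invDesClass (n - 1) J)"

context
  fixes n :: nat
  assumes n: "n \<ge> 2"
begin

lemma rotated_class_eq:
  "rotated_class n J = {(cyc n ^^ j) \<circ> \<sigma> | j \<sigma>. j < n \<and> \<sigma> permutes {1..n} \<and> \<sigma> n = n \<and> Des (n - 1) (inv \<sigma>) = J}"
proof -
  have "invDesClass (n - 1) J = {\<sigma>. \<sigma> permutes {1..n} \<and> \<sigma> n = n \<and> Des (n - 1) (inv \<sigma>) = J}"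
  proof -
    have p: "s permutes {1..n-1} \<longleftrightarrow> s permutes {1..n} \<and> s n = n" for s
    proof
      assume s: "s permutes {1..n-1}"
      show "s permutes {1..n} \<and> s n = n"
        using permutes_subset[OF s, of "{1..n}"] permutes_not_in[OF s, of n] n by auto
    next
      assume s: "s permutes {1..n} \<and> s n = n"
      show "s permutes {1..n-1}"
        by (rule permutes_superset[of s "{1..n}"]) (use s in \<open>auto dest: le_neq_implies_less\<close>)
    qed
    show ?thesis
    proof
      show "invDesClass (n - 1) J \<subseteq> {\<sigma>. \<sigma> permutes {1..n} \<and> \<sigma> n = n \<and> Des (n - 1) (inv \<sigma>) = J}"
        unfolding invDesClass_def using p by (auto dest: permutes_inv simp: permutes_inv_inv)
      show "{\<sigma>. \<sigma> permutes {1..n} \<and> \<sigma> n = n \<and> Des (n - 1) (inv \<sigma>) = J} \<subseteq> invDesClass (n - 1) J"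
      proof
        fix \<sigma> assume s: "\<sigma> \<in> {\<sigma>. \<sigma> permutes {1..n} \<and> \<sigma> n = n \<and> Des (n - 1) (inv \<sigma>) = J}"
        then have s': "\<sigma> permutes {1..n-1}" using p by blast
        then have "inv \<sigma> \<in> {s. s permutes {1..n-1} \<and> Des (n - 1) s = J}"
          using permutes_inv[OF s'] s by simp
        then show "\<sigma> \<in> invDesClass (n - 1) J"
          unfolding invDesClass_def using permutes_inv_inv[OF s'] by (metis image_eqI)
      qed
    qed
  qed
  then show ?thesis by (simp only: rotClass_def mem_Collect_eq)
qed

text \<open>Both permutations fix \<open>n\<close>, so the image of \<open>n\<close> reveals the
  exponent.\<close>

lemma rotated_class_unique:
  assumes "\<sigma> permutes {1..n}" "\<sigma> n = n" "\<tau> permutes {1..n}" "\<tau> n = n" "i < n" "j < n"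
    and eq: "(cyc n ^^ i) \<circ> \<sigma> = (cyc n ^^ j) \<circ> \<tau>"
  shows "\<sigma> = \<tau>"
proof -
  have "(cyc n ^^ i) n = (cyc n ^^ j) n" using fun_cong[OF eq, of n] assms(2,4) by (simp only: comp_apply)
  then have "i = j" using assms n by (simp add: cyc_funpow split: if_splits)
  moreover have "inj (cyc n ^^ j)" using permutes_inj[OF permutes_funpow[OF cyc_permutes]] n by simp
  ultimately show ?thesis using fun_cong[OF eq] by (intro ext) (metis comp_apply injD)
qed

lemma rotated_class_permutes: "\<pi> \<in> rotated_class n J \<Longrightarrow> \<pi> permutes {1..n}"
proof -
  assume "\<pi> \<in> rotated_class n J"
  then obtain j \<sigma> where "\<pi> = (cyc n ^^ j) \<circ> \<sigma>" "\<sigma> permutes {1..n}" unfolding rotated_class_eq by blast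
  moreover have "(cyc n ^^ j) permutes {1..n}" by (rule permutes_funpow[OF cyc_permutes]) (use n in simp)
  ultimately show ?thesis by (simp only: permutes_compose)
qed

lemma rotated_class_disjoint: "\<pi> \<in> rotated_class n J \<Longrightarrow> \<pi> \<in> rotated_class n K \<Longrightarrow> J = K"
  unfolding rotated_class_eq using rotated_class_unique by blast

lemma finite_rotated_class: "finite (rotated_class n J)"
  by (rule finite_subset[OF _ finite_permutations[of "{1..n}"]]) (use rotated_class_permutes in auto)

lemma finite_box_perms: "finite (box_perms n J)"
  by (rule finite_subset[OF _ finite_permutations[of "{1..n}"]]) (auto simp: box_perms_def)

lemma rotate_back_Suc:
  assumes "z \<in> {1..n}" "z < n" "r \<in> {1..n}"
  shows "rotate_back n r (Suc z) = (if rotate_back n r z = n then 1 else rotate_back n r z + 1)"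
  using assms by (auto simp: rotate_back_def)

lemma rotate_back_in: "z \<in> {1..n} \<Longrightarrow> r \<in> {1..n} \<Longrightarrow> rotate_back n r z \<in> {1..n}"
  by (auto simp: rotate_back_def)

text \<open>As \<open>n \<in> S\<close>, every \<open>z\<close> outside \<open>S\<close> has
  \<open>Suc z \<le> n\<close>, and rotating back sends \<open>Suc z\<close> to the cyclic successor
  of the image of \<open>z\<close>.\<close>

lemma rotate_set_subset_iff:
  assumes "\<pi> permutes {1..n}" "n \<in> S" "r \<in> {1..n}"
  shows "rotate_set n r (cDes n \<pi>) \<subseteq> S \<longleftrightarrow>
    (\<forall>z\<in>{1..n}-S. \<pi> (rotate_back n r z) < \<pi> (rotate_back n r (Suc z)))"
proof -
  have "rotate_back n r z \<notin> cDes n \<pi> \<longleftrightarrow> \<pi> (rotate_back n r z) < \<pi> (rotate_back n r (Suc z))"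
    if z: "z \<in> {1..n} - S" for z
  proof -
    have zn: "z \<in> {1..n}" "z < n" using z assms(2) by (auto simp: le_less)
    let ?x = "rotate_back n r z" and ?y = "rotate_back n r (Suc z)"
    have "?x \<noteq> ?y" using rotate_back_Suc[OF zn assms(3)] n by auto
    then have "\<pi> ?x \<noteq> \<pi> ?y" using permutes_inj[OF assms(1)] by (metis injD)
    moreover have "?x \<in> cDes n \<pi> \<longleftrightarrow> \<pi> ?x > \<pi> ?y"
      using rotate_back_in[OF zn(1) assms(3)] rotate_back_Suc[OF zn assms(3)] by (simp add: cDes_def)
    ultimately show ?thesis by linarith
  qed
  then show ?thesis unfolding rotate_set_def by blast
qed

lemma Des_subset_iff:
  assumes "\<rho> permutes {1..n}" "n \<in> S"
  shows "Des n \<rho> \<subseteq> S \<longleftrightarrow> (\<forall>z\<in>{1..n}-S. \<rho> z < \<rho> (Suc z))"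
proof -
  have "z \<notin> Des n \<rho> \<longleftrightarrow> \<rho> z < \<rho> (Suc z)" if z: "z \<in> {1..n} - S" for z
  proof -
    have "z < n" using z assms(2) by (auto simp: le_less)
    moreover have "\<rho> z \<noteq> \<rho> (Suc z)" using permutes_inj[OF assms(1)] by (metis injD n_not_Suc_n)
    ultimately show ?thesis using z by (auto simp: Des_def Suc_eq_plus1[symmetric] simp del: Suc_eq_plus1)
  qed
  moreover have "Des n \<rho> \<subseteq> {1..n}" by (auto simp: Des_def)
  ultimately show ?thesis by blast
qed

context
  fixes J :: "nat set"
  assumes J: "J \<subseteq> {1..n-2}"
begin

lemma card_J_less: "card {l\<in>J. l < i} < n"
proof -
  have "card {l\<in>J. l < i} \<le> card {1..n-2}" using J by (intro card_mono) auto
  then show ?thesis using n by simp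
qed

lemma blocks_mono: "mono_on {1..n} (blocks n J)"
proof (rule mono_onI)
  fix i j assume ij: "i \<in> {1..n}" "j \<in> {1..n}" "i \<le> j"
  have fin: "finite J" using J finite_subset by blast
  have "card {l\<in>J. l < i} \<le> card {l\<in>J. l < j}" using ij fin by (intro card_mono) auto
  then show "blocks n J i \<le> blocks n J j" using ij card_J_less[of i] by (simp add: blocks_def)
qed

lemma blocks_less: "i \<in> {1..<n} \<Longrightarrow> blocks n J i < blocks n J n"
  using card_J_less[of i] by (simp add: blocks_def)

lemma blocks_eq_iff:
  assumes i: "i \<in> {1..<n}"
  shows "blocks n J i = blocks n J (Suc i) \<longleftrightarrow> i \<le> n - 2 \<and> i \<notin> J"
proof (cases "i = n - 1")
  case True
  then have "Suc i = n" using n by simp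
  then show ?thesis using blocks_less[OF i] True n by auto
next
  case False
  then have lt: "Suc i < n" "i \<le> n - 2" using i by auto
  have "{j\<in>J. j < Suc i} = {j\<in>J. j < i} \<union> (if i \<in> J then {i} else {})" by (auto simp: less_Suc_eq)
  moreover have "finite {j\<in>J. j < i}" by simp
  ultimately show ?thesis using lt by (auto simp: blocks_def)
qed

lemma block_perms_blocks:
  "block_perms n (blocks n J) = {\<rho>. \<rho> permutes {1..n} \<and> Des (n - 1) (inv \<rho>) \<subseteq> J}"
proof -
  have "(\<forall>i\<in>{1..<n}. blocks n J i = blocks n J (Suc i) \<longrightarrow> inv \<rho> i < inv \<rho> (Suc i)) \<longleftrightarrow>
    Des (n - 1) (inv \<rho>) \<subseteq> J" if "\<rho> permutes {1..n}" for \<rho>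
  proof -
    have "inv \<rho> i \<noteq> inv \<rho> (Suc i)" for i using permutes_inj[OF permutes_inv[OF that]] by (metis injD n_not_Suc_n)
    then have lt: "inv \<rho> i < inv \<rho> (Suc i) \<longleftrightarrow> \<not> inv \<rho> i > inv \<rho> (Suc i)" for i by (metis linorder_neqE_nat not_less_iff_gr_or_eq)
    have "(\<forall>i\<in>{1..<n}. blocks n J i = blocks n J (Suc i) \<longrightarrow> inv \<rho> i < inv \<rho> (Suc i)) \<longleftrightarrow>
      (\<forall>i\<in>{1..<n}. i \<le> n - 2 \<and> i \<notin> J \<longrightarrow> inv \<rho> i < inv \<rho> (Suc i))" using blocks_eq_iff by auto
    also have "\<dots> \<longleftrightarrow> (\<forall>i\<in>{1..n-2}. i \<notin> J \<longrightarrow> inv \<rho> i < inv \<rho> (Suc i))" using n by auto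
    also have "\<dots> \<longleftrightarrow> Des (n - 1) (inv \<rho>) \<subseteq> J" unfolding lt Des_def using n by (auto simp: numeral_2_eq_2 One_nat_def)
    finally show ?thesis .
  qed
  then show ?thesis unfolding block_perms_def by blast
qed

lemma block_perms_blocks_UN: "block_perms n (blocks n J) = (\<Union>K\<in>Pow J. box_perms n K)"
  unfolding block_perms_blocks box_perms_def by blast

lemma rot_perms_blocks_UN: "rot_perms n (blocks n J) = (\<Union>K\<in>Pow J. rotated_class n K)"
  unfolding rot_perms_def block_perms_blocks rotated_class_eq by blast

text \<open>Words only control inverse descent sets contained in \<open>J\<close>. These split
  disjointly according to the exact set \<open>K\<close>, so \<open>card_rot_perms\<close> becomes
  an identity of sums over subsets.\<close>

lemma sum_card_eq:
  assumes S: "n \<in> S" "S \<subseteq> {1..n}" and r: "r \<in> {1..n}"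
  shows "(\<Sum>K\<in>Pow J. card {\<pi>\<in>rotated_class n K. rotate_set n r (cDes n \<pi>) \<subseteq> S}) =
    (\<Sum>K\<in>Pow J. card {\<rho>\<in>box_perms n K. Des n \<rho> \<subseteq> S})"
proof -
  interpret cut_words n S r "blocks n J" using S r blocks_less by unfold_locales auto
  have fin: "finite (Pow J)" using J finite_subset by blast
  have rot: "rot z = rotate_back n r z" if "z \<in> {1..n}" for z
    using that by (simp add: rot_def)
  have "(\<Sum>K\<in>Pow J. card {\<pi>\<in>rotated_class n K. rotate_set n r (cDes n \<pi>) \<subseteq> S}) =
    card (\<Union>K\<in>Pow J. {\<pi>\<in>rotated_class n K. rotate_set n r (cDes n \<pi>) \<subseteq> S})"
  proof (rule card_UN_disjoint[symmetric])
    show "\<forall>K\<in>Pow J. finite {\<pi>\<in>rotated_class n K. rotate_set n r (cDes n \<pi>) \<subseteq> S}"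
      using finite_rotated_class by simp
  qed (use fin rotated_class_disjoint in blast)+
  also have "(\<Union>K\<in>Pow J. {\<pi>\<in>rotated_class n K. rotate_set n r (cDes n \<pi>) \<subseteq> S}) =
    {\<pi>\<in>rot_perms n (blocks n J). \<forall>z\<in>{1..n}-S. \<pi> (rot z) < \<pi> (rot (Suc z))}"
  proof -
    have "rotate_set n r (cDes n \<pi>) \<subseteq> S \<longleftrightarrow> (\<forall>z\<in>{1..n}-S. \<pi> (rot z) < \<pi> (rot (Suc z)))"
      if "\<pi> \<in> rotated_class n K" for \<pi> K
      using rotate_set_subset_iff[OF rotated_class_permutes[OF that] S(1) r] rot block_end_Suc by simp
    then show ?thesis unfolding rot_perms_blocks_UN by blast
  qed
  also have "card \<dots> = card {\<rho>\<in>block_perms n (blocks n J). \<forall>z\<in>{1..n}-S. \<rho> z < \<rho> (Suc z)}"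
    by (rule card_rot_perms[OF blocks_mono])
  also have "{\<rho>\<in>block_perms n (blocks n J). \<forall>z\<in>{1..n}-S. \<rho> z < \<rho> (Suc z)} =
    (\<Union>K\<in>Pow J. {\<rho>\<in>box_perms n K. Des n \<rho> \<subseteq> S})"
  proof -
    have "Des n \<rho> \<subseteq> S \<longleftrightarrow> (\<forall>z\<in>{1..n}-S. \<rho> z < \<rho> (Suc z))" if "\<rho> \<in> box_perms n K" for \<rho> K
      using that by (intro Des_subset_iff S) (simp add: box_perms_def)
    then show ?thesis unfolding block_perms_blocks_UN by blast
  qed
  also have "card \<dots> = (\<Sum>K\<in>Pow J. card {\<rho>\<in>box_perms n K. Des n \<rho> \<subseteq> S})"
  proof (rule card_UN_disjoint)
    show "\<forall>K\<in>Pow J. finite {\<rho>\<in>box_perms n K. Des n \<rho> \<subseteq> S}" using finite_box_perms by simp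
  qed (use fin in \<open>auto simp: box_perms_def\<close>)
  finally show ?thesis .
qed

end

text \<open>Inversion over the subsets of \<open>J\<close> isolates \<open>J\<close> itself. The
  right side is independent of \<open>r\<close>, which is the source of rotation invariance.\<close>

lemma card_rotated_class_subset:
  assumes "J \<subseteq> {1..n-2}" "n \<in> S" "S \<subseteq> {1..n}" "r \<in> {1..n}"
  shows "card {\<pi>\<in>rotated_class n J. rotate_set n r (cDes n \<pi>) \<subseteq> S} = card {\<rho>\<in>box_perms n J. Des n \<rho> \<subseteq> S}"
  by (rule subset_sums_determine[OF _ sum_card_eq assms(1)]) (use assms in auto)

section \<open>Matching descents by bijections\<close>

lemma cDes_subset: "cDes n \<pi> \<subseteq> {1..n}"
  by (auto simp: cDes_def)

text \<open>The position of the value \<open>n\<close> is a cyclic descent and the position of the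
  value 1 is not.\<close>

lemma cDes_nonempty_proper:
  assumes "\<pi> permutes {1..n}"
  shows "cDes n \<pi> \<noteq> {}" "cDes n \<pi> \<noteq> {1..n}"
proof -
  have ip: "inv \<pi> permutes {1..n}" by (rule permutes_inv[OF assms])
  have pos: "inv \<pi> v \<in> {1..n}" "\<pi> (inv \<pi> v) = v" if "v \<in> {1..n}" for v
    using that permutes_in_image[OF ip] permutes_inverses[OF assms] by blast+
  let ?s = "\<lambda>i. if i = n then 1 else i + 1"
  have s: "\<pi> (?s i) \<in> {1..n}" "\<pi> (?s i) \<noteq> \<pi> i" if "i \<in> {1..n}" for i
  proof -
    have "?s i \<in> {1..n}" "?s i \<noteq> i" using that n by auto
    then show "\<pi> (?s i) \<in> {1..n}" "\<pi> (?s i) \<noteq> \<pi> i"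
      using permutes_in_image[OF assms] permutes_inj[OF assms] by (blast, metis injD)
  qed
  have vn: "n \<in> {1..n}" "1 \<in> {1..n}" using n by auto
  have "\<pi> (?s (inv \<pi> n)) < \<pi> (inv \<pi> n)" using s[OF pos(1)[OF vn(1)]] pos(2)[OF vn(1)] by simp
  then have "inv \<pi> n \<in> cDes n \<pi>" using pos(1)[OF vn(1)] unfolding cDes_def by blast
  then show "cDes n \<pi> \<noteq> {}" by blast
  have "\<not> \<pi> (?s (inv \<pi> 1)) < \<pi> (inv \<pi> 1)" using s[OF pos(1)[OF vn(2)]] pos(2)[OF vn(2)] by simp
  then have "inv \<pi> 1 \<notin> cDes n \<pi>" unfolding cDes_def by blast
  then show "cDes n \<pi> \<noteq> {1..n}" using pos(1)[OF vn(2)] by blast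
qed

lemma rotate_set_n: "C \<subseteq> {1..n} \<Longrightarrow> rotate_set n n C = C"
  by (auto simp: rotate_set_def rotate_back_def)

lemma rotate_set_mono_iff:
  assumes "C \<subseteq> {1..n}" "r \<in> {1..n}"
  shows "rotate_set n r C \<subseteq> rotate_set n r T \<longleftrightarrow> C \<subseteq> T"
proof
  assume sub: "rotate_set n r C \<subseteq> rotate_set n r T"
  show "C \<subseteq> T"
  proof
    fix c assume c: "c \<in> C"
    define z where "z = (if c + r \<le> n then c + r else c + r - n)"
    have "z \<in> {1..n}" "rotate_back n r z = c" using c assms by (auto simp: z_def rotate_back_def)
    then have "z \<in> rotate_set n r C" using c by (simp add: rotate_set_def)
    then show "c \<in> T" using sub \<open>rotate_back n r z = c\<close> by (auto simp: rotate_set_def)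
  qed
qed (auto simp: rotate_set_def)

lemma rotate_set_shift1:
  assumes C: "C \<subseteq> {1..n}" and r: "r \<in> {1..n}"
  shows "rotate_set n r (shift1 n C) = rotate_set n (if r = n then 1 else r + 1) C"
proof -
  let ?r = "if r = n then 1 else r + 1" and ?s = "\<lambda>i. if i = n then 1 else i + 1"
  have inj: "inj_on ?s {1..n}" by (rule inj_onI) (auto split: if_splits)
  have "rotate_back n r z \<in> ?s ` C \<longleftrightarrow> rotate_back n ?r z \<in> C" if z: "z \<in> {1..n}" for z
  proof -
    have "rotate_back n r z = ?s (rotate_back n ?r z)" using z r by (auto simp: rotate_back_def)
    moreover have "rotate_back n ?r z \<in> {1..n}" using z r by (intro rotate_back_in) auto
    ultimately show ?thesis using inj_on_image_mem_iff[OF inj _ C] by simp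
  qed
  then show ?thesis unfolding rotate_set_def shift1_def by blast
qed

text \<open>Shifting the cyclic descent set replaces the rotation \<open>r\<close> by its cyclic
  successor with \<open>S\<close> unchanged, and the count is the same for both.\<close>

lemma rotated_class_shift_bij:
  assumes J: "J \<subseteq> {1..n-2}"
  obtains \<psi> where "bij_betw \<psi> (rotated_class n J) (rotated_class n J)"
    "\<And>\<pi>. \<pi> \<in> rotated_class n J \<Longrightarrow> cDes n (\<psi> \<pi>) = shift1 n (cDes n \<pi>)"
proof -
  have count: "card {\<pi>\<in>rotated_class n J. shift1 n (cDes n \<pi>) \<subseteq> T} = card {\<pi>\<in>rotated_class n J. cDes n \<pi> \<subseteq> T}"
    if T: "T \<subseteq> {1..n}" for T
  \<comment> \<open>The count applies to sets containing \<open>n\<close>, and only a nonempty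
    \<open>T\<close> can be rotated into such a set.\<close>
  proof (cases "T = {}")
    case True
    have "cDes n \<pi> \<noteq> {}" if "\<pi> \<in> rotated_class n J" for \<pi>
      using cDes_nonempty_proper(1)[OF rotated_class_permutes[OF that]] .
    then have "{\<pi>\<in>rotated_class n J. shift1 n (cDes n \<pi>) \<subseteq> T} = {}" "{\<pi>\<in>rotated_class n J. cDes n \<pi> \<subseteq> T} = {}"
      using True by (auto simp: shift1_def)
    then show ?thesis by (simp only: card.empty)
  next
    case False
    then obtain i where i: "i \<in> T" by blast
    \<comment> \<open>Rotation by \<open>r\<close> moves \<open>i\<close> to \<open>n\<close>; for
      \<open>i = n\<close> the full turn \<open>n\<close> is taken to stay in
      \<open>{1..n}\<close>.\<close>
    define r where "r = (if i = n then n else n - i)"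
    define r' where "r' = (if r = n then 1 else r + 1)"
    define S where "S = rotate_set n r T"
    have i': "i \<in> {1..n}" using i T by blast
    have r: "r \<in> {1..n}" "r' \<in> {1..n}" using i' n by (auto simp: r_def r'_def)
    have "rotate_back n r n = i" using i' by (auto simp: rotate_back_def r_def)
    then have nS: "n \<in> S" "S \<subseteq> {1..n}" using i n by (auto simp: S_def rotate_set_def)
    have "cDes n \<pi> \<subseteq> T \<longleftrightarrow> rotate_set n r (cDes n \<pi>) \<subseteq> S" for \<pi>
      using rotate_set_mono_iff[OF cDes_subset r(1)] by (simp add: S_def)
    moreover have "shift1 n (cDes n \<pi>) \<subseteq> T \<longleftrightarrow> rotate_set n r' (cDes n \<pi>) \<subseteq> S" for \<pi>
    proof -
      have "shift1 n (cDes n \<pi>) \<subseteq> {1..n}" using cDes_subset[of \<pi>] n by (auto simp: shift1_def)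
      from rotate_set_mono_iff[OF this r(1), of T] show ?thesis
        unfolding rotate_set_shift1[OF cDes_subset r(1)] S_def r'_def by blast
    qed
    ultimately show ?thesis
      using card_rotated_class_subset[OF J nS r(1)] card_rotated_class_subset[OF J nS r(2)] by simp
  qed
  have sub: "shift1 n (cDes n \<pi>) \<subseteq> {1..n}" for \<pi>
    using cDes_subset[of \<pi>] n by (auto simp: shift1_def)
  show thesis
    by (rule equidistributed_bij[OF finite_rotated_class finite_rotated_class finite_atLeastAtMost sub cDes_subset count that])
qed

text \<open>The case of the trivial rotation \<open>r = n\<close>: adding \<open>n\<close> to
  \<open>T\<close> removes any condition at the cyclic place \<open>n\<close>.\<close>

lemma box_perms_rotated_class_bij:
  assumes J: "J \<subseteq> {1..n-2}"
  obtains \<phi> where "bij_betw \<phi> (box_perms n J) (rotated_class n J)"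
    "\<And>\<rho>. \<rho> \<in> box_perms n J \<Longrightarrow> cDes n (\<phi> \<rho>) \<inter> {1..n-1} = Des n \<rho>"
proof -
  have "card {\<rho>\<in>box_perms n J. Des n \<rho> \<subseteq> T} = card {\<pi>\<in>rotated_class n J. cDes n \<pi> \<inter> {1..n-1} \<subseteq> T}"
    if T: "T \<subseteq> {1..n-1}" for T
  proof -
    have U: "{1..n} = insert n {1..n-1}" using n by auto
    have notin: "n \<notin> {1..n-1}" using n by simp
    have "Des n \<rho> \<subseteq> {1..n-1}" for \<rho> by (auto simp: Des_def)
    then have 1: "Des n \<rho> \<subseteq> T \<longleftrightarrow> Des n \<rho> \<subseteq> insert n T" for \<rho> using notin by blast
    have 2: "cDes n \<pi> \<inter> {1..n-1} \<subseteq> T \<longleftrightarrow> rotate_set n n (cDes n \<pi>) \<subseteq> insert n T" for \<pi>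
    proof -
      have "cDes n \<pi> \<subseteq> insert n {1..n-1}" using cDes_subset[of \<pi>] U by simp
      then show ?thesis unfolding rotate_set_n[OF cDes_subset] using T notin by blast
    qed
    have "insert n T \<subseteq> {1..n}" using T unfolding U by blast
    then show ?thesis unfolding 1 2 using card_rotated_class_subset[OF J, of "insert n T" n] n by simp
  qed
  then show thesis
    by (intro equidistributed_bij[of "box_perms n J" "rotated_class n J" "{1..n-1}" "Des n"
          "\<lambda>\<pi>. cDes n \<pi> \<inter> {1..n-1}", OF finite_box_perms finite_rotated_class finite_atLeastAtMost _ _ _ that])
      (auto simp: Des_def)
qed

end

section \<open>Skew diagrams\<close>

lemma down_set_is_young:
  assumes fin: "finite Y" and down: "\<And>i j i' j'. (i, j) \<in> Y \<Longrightarrow> i' \<le> i \<Longrightarrow> j' \<le> j \<Longrightarrow> (i', j') \<in> Y"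
  obtains lam where "partition lam" "young lam = Y"
proof -
  have initial: "A = {..<card A}" if "finite A" "\<And>a b. a \<in> A \<Longrightarrow> b \<le> a \<Longrightarrow> b \<in> A" for A :: "nat set"
  proof (cases "A = {}")
    case False
    have "A = {..Max A}" using that False Max_in[of A] Max_ge[of A] by blast
    then show ?thesis by (metis card_atMost lessThan_Suc_atMost)
  qed simp
  define r where "r i = card {j. (i, j) \<in> Y}" for i
  define m where "m = card {i. (i, 0) \<in> Y}"
  have finr: "finite {j. (i, j) \<in> Y}" for i
    by (rule finite_subset[of _ "snd ` Y"]) (use fin in force)+
  have fin0: "finite {i. (i, 0) \<in> Y}"
    by (rule finite_subset[of _ "fst ` Y"]) (use fin in force)+
  have row: "(i, j) \<in> Y \<longleftrightarrow> j < r i" for i j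
    using initial[OF finr[of i]] down unfolding r_def by blast
  have col: "(i, 0) \<in> Y \<longleftrightarrow> i < m" for i
    using initial[OF fin0] down unfolding m_def by blast
  define lam where "lam = map r [0..<m]"
  have "partition lam"
    unfolding partition_def
  proof
    have "r j \<le> r i" if "i \<le> j" for i j
      using down[of j "r j - 1" i "r j - 1"] row[of j "r j - 1"] row[of i "r j - 1"] that by (cases "r j") auto
    then show "sorted_wrt (\<ge>) lam" by (simp add: lam_def sorted_wrt_iff_nth_less)
    have "r i \<noteq> 0" if "i < m" for i using row[of i 0] col[of i] that by simp
    then have "r i \<noteq> 0" if "i \<in> set [0..<m]" for i using that by (metis atLeastLessThan_iff set_upt)
    then show "0 \<notin> set lam" unfolding lam_def set_map by (metis imageE)
  qed
  moreover have "young lam = Y"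
  proof -
    have "(i, j) \<in> young lam \<longleftrightarrow> (i, j) \<in> Y" for i j
      using row[of i j] col[of i] down[of i j i 0] by (auto simp: young_def lam_def)
    then show ?thesis by auto
  qed
  ultimately show thesis by (rule that)
qed

text \<open>The outer partition is the down-closure \<open>Y\<close> of \<open>D\<close> and the
  inner one is \<open>Y - D\<close>. Convexity makes the latter a down-set, since a cell of
  \<open>Y\<close> lying between cells of \<open>D\<close> belongs to \<open>D\<close>.\<close>

lemma convex_is_skew_diagram:
  assumes fin: "finite D"
    and conv: "\<And>i j i' j' i'' j''. (i, j) \<in> D \<Longrightarrow> (i'', j'') \<in> D \<Longrightarrow> i \<le> i' \<Longrightarrow> i' \<le> i'' \<Longrightarrow> j \<le> j' \<Longrightarrow> j' \<le> j''
      \<Longrightarrow> (i', j') \<in> D"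
  obtains lam mu where "skew_shape lam mu (card D)" "skew_diagram lam mu = D"
proof -
  define Y where "Y = {(i, j). \<exists>i' j'. (i', j') \<in> D \<and> i \<le> i' \<and> j \<le> j'}"
  have "Y = (\<Union>(i', j')\<in>D. {..i'} \<times> {..j'})" by (auto simp: Y_def)
  then have finY: "finite Y" using fin by auto
  have DY: "D \<subseteq> Y" by (auto simp: Y_def)
  obtain lam where lam: "partition lam" "young lam = Y"
  proof (rule down_set_is_young[OF finY])
    fix i j i' j' assume "(i, j) \<in> Y" "i' \<le> i" "j' \<le> j"
    then show "(i', j') \<in> Y" unfolding Y_def by (blast intro: order_trans)
  qed
  obtain mu where mu: "partition mu" "young mu = Y - D"
  proof (rule down_set_is_young[of "Y - D"])
    fix i j i' j' assume ij: "(i, j) \<in> Y - D" and le: "i' \<le> i" "j' \<le> j"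
    obtain i'' j'' where "(i'', j'') \<in> D" "i \<le> i''" "j \<le> j''" using ij by (auto simp: Y_def)
    then show "(i', j') \<in> Y - D" using ij le conv[of i' j' i'' j'' i j] by (auto simp: Y_def intro: order_trans)
  qed (use finY in auto)
  have "skew_diagram lam mu = D" using lam mu DY by (auto simp: skew_diagram_def)
  moreover from this have "skew_shape lam mu (card D)" using lam mu by (auto simp: skew_shape_def)
  ultimately show thesis using that by blast
qed

lemma nat_ivt:
  fixes f :: "nat \<Rightarrow> nat"
  assumes "i \<le> k" "\<And>j. i \<le> j \<Longrightarrow> j < k \<Longrightarrow> f (Suc j) \<le> Suc (f j)" "f i \<le> v" "v \<le> f k"
  shows "\<exists>j. i \<le> j \<and> j \<le> k \<and> f j = v"
  using assms
proof (induction k rule: dec_induct)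
  case base
  then show ?case by (intro exI[of _ i]) simp
next
  case (step k)
  show ?case
  proof (cases "v \<le> f k")
    case True
    then show ?thesis using step by (meson le_SucI less_SucI)
  next
    case False
    moreover have "f (Suc k) \<le> Suc (f k)" using step by simp
    ultimately have "f (Suc k) = v" using step by linarith
    then show ?thesis using step by (intro exI[of _ "Suc k"]) simp
  qed
qed

lemma nat_ivt_decreasing:
  fixes f :: "nat \<Rightarrow> nat"
  assumes "i \<le> k" "\<And>j. i \<le> j \<Longrightarrow> j < k \<Longrightarrow> f j \<le> Suc (f (Suc j))" "f k \<le> v" "v \<le> f i"
  shows "\<exists>j. i \<le> j \<and> j \<le> k \<and> f j = v"
  using assms
proof (induction k rule: dec_induct)
  case base
  then show ?case by (intro exI[of _ i]) simp
next
  case (step k)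
  show ?case
  proof (cases "f k \<le> v")
    case True
    then show ?thesis using step by (meson le_SucI less_SucI)
  next
    case False
    moreover have "f k \<le> Suc (f (Suc k))" using step by simp
    ultimately have "f (Suc k) = v" using step by linarith
    then show ?thesis using step by (intro exI[of _ "Suc k"]) simp
  qed
qed

section \<open>The ribbon with an extra box\<close>

locale ribbon_box =
  fixes n :: nat and J :: "nat set"
  assumes n: "n \<ge> 2" and J: "J \<subseteq> {1..n-2}"
begin

text \<open>Cells are numbered from the bottom left. From \<open>i\<close> the next cell lies above
  if \<open>i \<in> J\<close> and to the right if \<open>i \<notin> J\<close>. Inserting
  \<open>n - 1\<close> here, but not in \<open>col\<close>, makes the last step diagonal and
  detaches box \<open>n\<close>.\<close>

definition row :: "nat \<Rightarrow> nat" where "row i = card {j \<in> insert (n-1) J. i \<le> j}"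

definition col :: "nat \<Rightarrow> nat" where "col i = card {j \<in> {1..<i}. j \<notin> J}"

definition cell :: "nat \<Rightarrow> nat \<times> nat" where "cell i = (row i, col i)"

definition shape :: "(nat \<times> nat) set" where "shape = cell ` {1..n}"

lemma finite_J: "finite J"
  using J finite_subset by blast

lemma last_notin_J: "n - 1 \<notin> J"
proof
  assume "n - 1 \<in> J"
  then have "n - 1 \<le> n - 2" using J by auto
  then show False using n by linarith
qed

lemma row_Suc: "row i = row (Suc i) + (if i \<in> insert (n-1) J then 1 else 0)"
proof -
  have "{j \<in> insert (n-1) J. i \<le> j} = {j \<in> insert (n-1) J. Suc i \<le> j} \<union> (if i \<in> insert (n-1) J then {i} else {})"
    by (auto simp: Suc_le_eq le_less)
  moreover have "finite {j \<in> insert (n-1) J. Suc i \<le> j}" using finite_J by simp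
  ultimately show ?thesis by (simp add: row_def)
qed

lemma col_Suc: "1 \<le> i \<Longrightarrow> col (Suc i) = col i + (if i \<in> J then 0 else 1)"
proof -
  assume "1 \<le> i"
  then have "{j \<in> {1..<Suc i}. j \<notin> J} = {j \<in> {1..<i}. j \<notin> J} \<union> (if i \<in> J then {} else {i})"
    by (auto simp: less_Suc_eq)
  then show ?thesis by (simp add: col_def)
qed

lemma row_mono: "i \<le> k \<Longrightarrow> row k \<le> row i"
  unfolding row_def using finite_J by (intro card_mono) auto

lemma col_mono: "i \<le> k \<Longrightarrow> col i \<le> col k"
  unfolding col_def by (intro card_mono) auto

lemma same_row:
  assumes "row i = row k" "i \<le> j" "j < k"
  shows "j \<notin> insert (n-1) J"
proof
  assume "j \<in> insert (n-1) J"
  then have "row j = Suc (row (Suc j))" using row_Suc[of j] by simp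
  then show False using assms row_mono[of "Suc j" k] row_mono[of i j] by simp
qed

lemma same_col:
  assumes "col i = col k" "1 \<le> i" "i \<le> j" "j < k"
  shows "j \<in> J"
proof (rule ccontr)
  assume "j \<notin> J"
  then have "col (Suc j) = Suc (col j)" using col_Suc[of j] assms by simp
  then show False using assms col_mono[of "Suc j" k] col_mono[of i j] by simp
qed

lemma same_row_col:
  assumes "row i = row k" "col i = col k" "1 \<le> i" "i < k" shows False
  using same_row[OF assms(1) order_refl assms(4)] same_col[OF assms(2,3) order_refl assms(4)] by simp

lemma inj_cell: "inj_on cell {1..n}"
proof (rule inj_onI)
  fix i k assume ik: "i \<in> {1..n}" "k \<in> {1..n}" "cell i = cell k"
  then show "i = k" using same_row_col[of i k] same_row_col[of k i]
    by (cases i k rule: linorder_cases) (auto simp: cell_def)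
qed

lemma card_shape: "card shape = n"
  using card_image[OF inj_cell] by (simp add: shape_def)

text \<open>Along the numbering rows weakly decrease and columns weakly increase, so two comparable
  cells share a row or a column. Unit steps then reach every cell between them.\<close>

lemma shape_skew:
  obtains lam mu where "skew_shape lam mu n" "skew_diagram lam mu = shape"
proof -
  have "(i', j') \<in> shape" if ij: "(i, j) \<in> shape" "(i'', j'') \<in> shape" and le: "i \<le> i'" "i' \<le> i''" "j \<le> j'" "j' \<le> j''"
    for i j i' j' i'' j''
  proof -
    obtain a where a: "a \<in> {1..n}" "i = row a" "j = col a" using ij by (auto simp: shape_def cell_def)
    obtain c where c: "c \<in> {1..n}" "i'' = row c" "j'' = col c" using ij by (auto simp: shape_def cell_def)
    show ?thesis
    proof (cases "a \<le> c")
      case True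
      then have r: "row a = row c" "i' = row a" using row_mono[OF True] a c le by auto
      have "\<exists>b. a \<le> b \<and> b \<le> c \<and> col b = j'"
        by (rule nat_ivt[OF True]) (use a c le in \<open>auto simp: col_Suc\<close>)
      then obtain b where b: "a \<le> b" "b \<le> c" "col b = j'" by blast
      then have "row b = i'" using row_mono[OF b(1)] row_mono[OF b(2)] r by simp
      then have "(i', j') = cell b" "b \<in> {1..n}" using b a c by (auto simp: cell_def)
      then show ?thesis unfolding shape_def by (rule image_eqI)
    next
      case False
      then have ca: "c \<le> a" by simp
      then have r: "col a = col c" "j' = col a" using col_mono[OF ca] a c le by auto
      have "\<exists>b. c \<le> b \<and> b \<le> a \<and> row b = i'"
      proof (rule nat_ivt_decreasing[OF ca])
        show "row b \<le> Suc (row (Suc b))" for b using row_Suc[of b] by simp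
      qed (use a c le in auto)
      then obtain b where b: "c \<le> b" "b \<le> a" "row b = i'" by blast
      then have "col b = j'" using col_mono[OF b(1)] col_mono[OF b(2)] r by simp
      then have "(i', j') = cell b" "b \<in> {1..n}" using b a c by (auto simp: cell_def)
      then show ?thesis unfolding shape_def by (rule image_eqI)
    qed
  qed
  moreover have "finite shape" by (simp add: shape_def)
  ultimately obtain lam mu where "skew_shape lam mu (card shape)" "skew_diagram lam mu = shape"
    using convex_is_skew_diagram[of shape] by blast
  then show thesis using that card_shape by simp
qed

text \<open>All other cells lie in strictly lower rows and strictly further left than box
  \<open>n\<close>, so a path starting there never leaves it.\<close>

lemma shape_not_connected: "\<not> connected_ribbon shape"
proof
  assume "connected_ribbon shape"
  moreover have mem: "cell n \<in> shape" "cell 1 \<in> shape" using n by (auto simp: shape_def)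
  ultimately have "(\<lambda>u v. u \<in> shape \<and> v \<in> shape \<and> adjacent u v)\<^sup>*\<^sup>* (cell n) (cell 1)"
    by (auto simp: connected_ribbon_def)
  then have "cell 1 = cell n"
  proof (induction rule: rtranclp_induct)
    case (step u v)
    then obtain i where i: "i \<in> {1..n}" "v = cell i" by (auto simp: shape_def)
    have adj: "adjacent (cell n) (cell i)" using step i by simp
    show ?case
    proof (rule ccontr)
      assume "v \<noteq> cell n"
      then have "i < n" using i by (cases "i = n") auto
      then have le: "i \<le> n - 1" by simp
      have "row (n-1) = Suc (row n)" "col n = Suc (col (n-1))"
        using row_Suc[of "n-1"] col_Suc[of "n-1"] n last_notin_J by simp_all
      then have "row n < row i" "col i < col n" using row_mono[OF le] col_mono[OF le] by simp_all
      then show False using adj by (auto simp: adjacent_def cell_def)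
    qed
  qed simp
  then show False using inj_onD[OF inj_cell, of 1 n] n by simp
qed

section \<open>Reading tableaux along the ribbon\<close>

definition tab_word :: "(nat \<times> nat \<Rightarrow> nat) \<Rightarrow> nat \<Rightarrow> nat" where
  "tab_word T i = (if i \<in> {1..n} then T (cell i) else i)"

definition word_tab :: "(nat \<Rightarrow> nat) \<Rightarrow> nat \<times> nat \<Rightarrow> nat" where
  "word_tab w c = (if c \<in> shape then w (inv_into {1..n} cell c) else 0)"

definition ribbon_words :: "(nat \<Rightarrow> nat) set" where
  "ribbon_words = {w. w permutes {1..n} \<and> Des (n-1) w = J}"

lemma word_tab_cell: "i \<in> {1..n} \<Longrightarrow> word_tab w (cell i) = w i"
  using inv_into_f_f[OF inj_cell] by (simp add: word_tab_def shape_def)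

lemma bij_cell: "bij_betw cell {1..n} shape"
  using inj_cell by (simp add: bij_betw_def shape_def)

lemma tab_word_ribbon_words:
  assumes T: "T \<in> SYT shape n" shows "tab_word T \<in> ribbon_words"
proof -
  have b: "bij_betw T shape {1..n}" and lt: "\<And>a b. a \<in> shape \<Longrightarrow> b \<in> shape \<Longrightarrow> fst a \<le> fst b \<Longrightarrow> snd a \<le> snd b
      \<Longrightarrow> a \<noteq> b \<Longrightarrow> T a < T b"
    using T by (auto simp: SYT_def)
  have "bij_betw (T \<circ> cell) {1..n} {1..n}" by (rule bij_betw_trans[OF bij_cell b])
  then have "bij_betw (tab_word T) {1..n} {1..n}"
    by (rule bij_betw_cong[THEN iffD1, rotated]) (simp add: tab_word_def)
  then have p: "tab_word T permutes {1..n}" by (rule bij_imp_permutes) (auto simp: tab_word_def)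
  \<comment> \<open>The place \<open>n - 1\<close> is left out: its diagonal step joins incomparable
    cells.\<close>
  have step: "tab_word T i > tab_word T (i + 1) \<longleftrightarrow> i \<in> J" if i: "i \<in> {1..n-2}" for i
  proof -
    have ii: "i \<in> {1..n}" "Suc i \<in> {1..n}" "i \<noteq> n - 1" using i n by auto
    have m: "cell i \<in> shape" "cell (Suc i) \<in> shape" "cell i \<noteq> cell (Suc i)"
      using ii inj_onD[OF inj_cell, of i "Suc i"] by (auto simp: shape_def)
    have "T (cell (Suc i)) < T (cell i)" if "i \<in> J"
      by (rule lt) (use that m ii row_Suc[of i] col_Suc[of i] in \<open>auto simp: cell_def\<close>)
    moreover have "T (cell i) < T (cell (Suc i))" if "i \<notin> J"
      by (rule lt) (use that m ii row_Suc[of i] col_Suc[of i] in \<open>auto simp: cell_def\<close>)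
    ultimately have "T (cell (Suc i)) < T (cell i) \<longleftrightarrow> i \<in> J" by (cases "i \<in> J") simp_all
    then show ?thesis using ii unfolding Suc_eq_plus1[symmetric] by (simp add: tab_word_def)
  qed
  have "Des (n-1) (tab_word T) = J"
  proof -
    have "n - 1 - 1 = n - 2" by simp
    then show ?thesis unfolding Des_def using step J by auto
  qed
  then show ?thesis using p by (simp add: ribbon_words_def)
qed

text \<open>Comparable cells share a row or a column. Inside a row all steps of the word are ascents
  and inside a column all are descents, so chaining them gives the comparison.\<close>

lemma ribbon_words_less:
  assumes w: "w \<in> ribbon_words" and ik: "i \<in> {1..n}" "k \<in> {1..n}" "row i \<le> row k" "col i \<le> col k" "i \<noteq> k"
  shows "w i < w k"
proof -
  have p: "w permutes {1..n}" and D: "Des (n-1) w = J" using w by (auto simp: ribbon_words_def)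
  have step: "w j > w (Suc j) \<longleftrightarrow> j \<in> J" if "j \<in> {1..n-2}" for j
  proof -
    have "n - 1 - 1 = n - 2" by simp
    then show ?thesis using D that unfolding Des_def Suc_eq_plus1 by auto
  qed
  have ne: "w j \<noteq> w (Suc j)" for j using permutes_inj[OF p] by (metis injD n_not_Suc_n)
  show ?thesis
  proof (cases "i < k")
    case True
    then have r: "row i = row k" using row_mono[of i k] ik by simp
    show ?thesis
    proof (rule chain_induct[OF True])
      fix j assume j: "i \<le> j" "j < k"
      have "j \<notin> insert (n-1) J" using same_row[OF r j] .
      then have "j \<in> {1..n-2}" "j \<notin> J" using j ik by auto
      then show "w j < w (Suc j)" using step ne by (metis linorder_neqE_nat)
    qed simp
  next
    case False
    then have ki: "k < i" using ik by simp
    then have c: "col k = col i" using col_mono[of k i] ik by simp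
    show ?thesis
    proof (rule chain_induct[OF ki, where P = "\<lambda>a b. w b < w a"])
      fix j assume j: "k \<le> j" "j < i"
      have "j \<in> J" using same_col[OF c _ j] ik by simp
      then show "w (Suc j) < w j" using step J by blast
    qed simp
  qed
qed

lemma word_tab_SYT:
  assumes w: "w \<in> ribbon_words" shows "word_tab w \<in> SYT shape n"
proof -
  have p: "w permutes {1..n}" using w by (auto simp: ribbon_words_def)
  have "bij_betw (w \<circ> inv_into {1..n} cell) shape {1..n}"
    by (rule bij_betw_trans[OF bij_betw_inv_into[OF bij_cell] permutes_imp_bij[OF p]])
  then have "bij_betw (word_tab w) shape {1..n}"
    by (rule bij_betw_cong[THEN iffD1, rotated]) (simp add: word_tab_def)
  moreover have "word_tab w a < word_tab w b"
    if ab: "a \<in> shape" "b \<in> shape" "fst a \<le> fst b" "snd a \<le> snd b" "a \<noteq> b" for a b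
  proof -
    obtain i k where i: "i \<in> {1..n}" "a = cell i" "k \<in> {1..n}" "b = cell k" using ab by (auto simp: shape_def)
    then show ?thesis using ribbon_words_less[OF w i(1,3)] ab word_tab_cell by (auto simp: cell_def)
  qed
  ultimately show ?thesis by (auto simp: SYT_def word_tab_def)
qed

text \<open>A strictly lower row means an earlier cell. Conversely, if the cell of
  \<open>i + 1\<close> came earlier without being lower, it would share its row with the cell of
  \<open>i\<close> and precede it there, so \<open>i + 1\<close> would be smaller than
  \<open>i\<close>.\<close>

lemma syt_Des_word_tab:
  assumes w: "w \<in> ribbon_words" shows "syt_Des shape n (word_tab w) = Des n (inv w)"
proof -
  have p: "w permutes {1..n}" using w by (auto simp: ribbon_words_def)
  have inj: "inj_on (word_tab w) shape" using word_tab_SYT[OF w] by (auto simp: SYT_def bij_betw_def)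
  have iw: "inv w v \<in> {1..n}" "w (inv w v) = v" if "v \<in> {1..n}" for v
    using that permutes_in_image[OF permutes_inv[OF p]] permutes_inverses[OF p] by blast+
  have at: "inv_into shape (word_tab w) v = cell (inv w v)" if "v \<in> {1..n}" for v
  proof (rule inv_into_f_eq[OF inj])
    show "cell (inv w v) \<in> shape" using iw[OF that] by (simp add: shape_def)
    show "word_tab w (cell (inv w v)) = v" using iw[OF that] word_tab_cell by simp
  qed
  have "fst (cell (inv w (i + 1))) > fst (cell (inv w i)) \<longleftrightarrow> inv w i > inv w (i + 1)" if i: "i \<in> {1..n-1}" for i
  proof -
    have ii: "i \<in> {1..n}" "i + 1 \<in> {1..n}" using i by auto
    let ?a = "inv w i" and ?b = "inv w (i + 1)"
    have "?a > ?b" if "row ?b > row ?a" using that row_mono[of ?a ?b] by linarith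
    moreover have "row ?b > row ?a" if ab: "?a > ?b"
    proof (rule ccontr)
      assume "\<not> row ?b > row ?a"
      then have "row ?b \<le> row ?a" "col ?b \<le> col ?a" using col_mono[of ?b ?a] ab by auto
      then have "w ?b < w ?a" using ribbon_words_less[OF w iw(1)[OF ii(2)] iw(1)[OF ii(1)]] ab by simp
      then show False using iw ii by simp
    qed
    ultimately show ?thesis by (auto simp: cell_def)
  qed
  moreover have "i \<in> {1..n}" "i + 1 \<in> {1..n}" if "i \<in> {1..n-1}" for i using that by auto
  ultimately show ?thesis unfolding syt_Des_def Des_def using at by (intro Collect_cong) metis
qed

lemma box_perms_SYT_bij: "bij_betw (\<lambda>\<rho>. word_tab (inv \<rho>)) (box_perms n J) (SYT shape n)"
proof (rule bij_betw_byWitness[where f' = "\<lambda>T. inv (tab_word T)"])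
  have inv_in: "inv \<rho> \<in> ribbon_words" if "\<rho> \<in> box_perms n J" for \<rho>
    using that permutes_inv by (auto simp: box_perms_def ribbon_words_def)
  show "\<forall>\<rho>\<in>box_perms n J. inv (tab_word (word_tab (inv \<rho>))) = \<rho>"
  proof
    fix \<rho> assume r: "\<rho> \<in> box_perms n J"
    then have p: "\<rho> permutes {1..n}" by (simp add: box_perms_def)
    have "tab_word (word_tab (inv \<rho>)) = inv \<rho>"
      using word_tab_cell permutes_not_in[OF permutes_inv[OF p]] by (auto simp: tab_word_def fun_eq_iff)
    then show "inv (tab_word (word_tab (inv \<rho>))) = \<rho>" using permutes_inv_inv[OF p] by simp
  qed
  show "\<forall>T\<in>SYT shape n. word_tab (inv (inv (tab_word T))) = T"
  proof
    fix T assume T: "T \<in> SYT shape n"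
    then have "inv (inv (tab_word T)) = tab_word T"
      using tab_word_ribbon_words permutes_inv_inv by (auto simp: ribbon_words_def)
    moreover have "word_tab (tab_word T) c = T c" for c
    proof (cases "c \<in> shape")
      case True
      then obtain i where "i \<in> {1..n}" "c = cell i" by (auto simp: shape_def)
      then show ?thesis using word_tab_cell[of i] by (simp add: tab_word_def)
    next
      case False
      then show ?thesis using T by (cases c) (auto simp: SYT_def word_tab_def)
    qed
    ultimately show "word_tab (inv (inv (tab_word T))) = T" by auto
  qed
  show "(\<lambda>\<rho>. word_tab (inv \<rho>)) ` box_perms n J \<subseteq> SYT shape n"
    using inv_in word_tab_SYT by blast
  show "(\<lambda>T. inv (tab_word T)) ` SYT shape n \<subseteq> box_perms n J"
  proof safe
    fix T assume "T \<in> SYT shape n"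
    then have "tab_word T permutes {1..n}" "Des (n-1) (tab_word T) = J"
      using tab_word_ribbon_words by (auto simp: ribbon_words_def)
    then show "inv (tab_word T) \<in> box_perms n J"
      by (simp add: box_perms_def permutes_inv permutes_inv_inv[of _ "{1..n}"])
  qed
qed

lemma syt_Des_box_perms: "\<rho> \<in> box_perms n J \<Longrightarrow> syt_Des shape n (word_tab (inv \<rho>)) = Des n \<rho>"
proof -
  assume "\<rho> \<in> box_perms n J"
  then have p: "\<rho> permutes {1..n}" and D: "Des (n-1) (inv \<rho>) = J" by (auto simp: box_perms_def)
  then have "inv \<rho> \<in> ribbon_words" using permutes_inv[OF p] by (simp add: ribbon_words_def)
  from syt_Des_word_tab[OF this] show ?thesis using permutes_inv_inv[OF p] by simp
qed

end

section \<open>Cyclic Schur-positivity\<close>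

theorem theorem4p9:
  fixes n :: nat and J :: "nat set"
  assumes "n \<ge> 2" and "J \<subseteq> {1..n-2}"
  shows "cyclic_schur_positive n (rotClass n (invDesClass (n-1) J))"
proof -
  interpret ribbon_box n J using assms by unfold_locales
  let ?V = "rotClass n (invDesClass (n-1) J)" and ?Y = "SYT shape n"
  obtain \<psi> where \<psi>: "bij_betw \<psi> ?V ?V" "\<And>\<pi>. \<pi> \<in> ?V \<Longrightarrow> cDes n (\<psi> \<pi>) = shift1 n (cDes n \<pi>)"
    by (rule rotated_class_shift_bij[OF assms]) blast
  obtain \<phi> where \<phi>: "bij_betw \<phi> (box_perms n J) ?V"
    "\<And>\<rho>. \<rho> \<in> box_perms n J \<Longrightarrow> cDes n (\<phi> \<rho>) \<inter> {1..n-1} = Des n \<rho>"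
    by (rule box_perms_rotated_class_bij[OF assms]) blast
  define t where "t = inv_into (box_perms n J) (\<lambda>\<rho>. word_tab (inv \<rho>))"
  have t: "bij_betw t ?Y (box_perms n J)" "\<And>T. T \<in> ?Y \<Longrightarrow> word_tab (inv (t T)) = T"
    using bij_betw_inv_into[OF box_perms_SYT_bij] bij_betw_inv_into_right[OF box_perms_SYT_bij]
    by (auto simp: t_def)
  \<comment> \<open>This identification sends tableaux to the class so that descents of
    \<open>T\<close> are the cyclic descents of \<open>\<theta> T\<close> below
    \<open>n\<close>.\<close>
  define \<theta> where "\<theta> = \<phi> \<circ> t"
  have \<theta>: "bij_betw \<theta> ?Y ?V" unfolding \<theta>_def by (rule bij_betw_trans[OF t(1) \<phi>(1)])
  have \<theta>_in: "\<theta> T \<in> ?V" if "T \<in> ?Y" for T using bij_betwE[OF \<theta>] that by blast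
  define cD where "cD T = cDes n (\<theta> T)" for T
  \<comment> \<open>The shift bijection of the class is conjugated to the tableaux.\<close>
  define psi where "psi = inv_into ?Y \<theta> \<circ> (\<psi> \<circ> \<theta>)"
  have psi: "bij_betw psi ?Y ?Y"
    unfolding psi_def by (rule bij_betw_trans[OF bij_betw_trans[OF \<theta> \<psi>(1)] bij_betw_inv_into[OF \<theta>]])
  have "cyclic_descent_ext shape n cD psi"
    unfolding cyclic_descent_ext_def
  proof (intro conjI ballI psi)
    fix T assume T: "T \<in> ?Y"
    have tT: "t T \<in> box_perms n J" using bij_betwE[OF t(1)] T by blast
    have perm: "\<theta> T permutes {1..n}" using rotated_class_permutes[OF assms(1) \<theta>_in[OF T]] .
    show "cD T \<subseteq> {1..n}" unfolding cD_def by (rule cDes_subset[OF assms(1)])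
    show "cD T \<inter> {1..n-1} = syt_Des shape n T"
      using \<phi>(2)[OF tT] syt_Des_box_perms[OF tT] t(2)[OF T] by (simp add: cD_def \<theta>_def)
    have "\<psi> (\<theta> T) \<in> ?V" using bij_betwE[OF \<psi>(1)] \<theta>_in[OF T] by blast
    then have "\<theta> (psi T) = \<psi> (\<theta> T)"
      using bij_betw_inv_into_right[OF \<theta>] by (simp add: psi_def)
    then show "cD (psi T) = shift1 n (cD T)" using \<psi>(2)[OF \<theta>_in[OF T]] by (simp add: cD_def)
    show "cD T \<noteq> {}" "cD T \<noteq> {1..n}"
      unfolding cD_def using cDes_nonempty_proper[OF assms(1) perm] by blast+
  qed
  moreover have "genf (cDes n) ?V x = genf cD ?Y x" for x
    unfolding genf_def cD_def by (rule sum.reindex_bij_betw[OF \<theta>, symmetric])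
  moreover obtain lam mu where "skew_shape lam mu n" "skew_diagram lam mu = shape"
    by (rule shape_skew)
  ultimately show ?thesis unfolding cyclic_schur_positive_def using shape_not_connected
    \<comment> \<open>One skew shape with multiplicity one suffices.\<close>
    by (intro exI[of _ "[((lam, mu), cD)]"]) auto
qed

end
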